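(* Fix an integer $k\ge 2$ and $t\in(0,1]$, and let $n\to\infty$ along integers for which $tnk$ is an integer. For each such $n$ let $A_n\in M_{tnk}(\mathbb C)$ satisfy $\operatorname{Tr}[A_nA_n^*]=1$, and let $|\psi_n\rangle=\sum_{i,j=1}^{tnk}(A_n)_{ij}|i\rangle|j\rangle\in\mathbb C^{tnk}\otimes\mathbb C^{tnk}$. Assume: (Assumption 1) there is $m\in\mathbb C$ with $\frac{\operatorname{Tr}[A_n]}{\sqrt{tnk}}=m+O(n^{-2})$; (Assumption 2) $\|A_n\|_\infty=O(n^{-1/2})$ (operator norm). Let $Z_n=(\Phi_n^C\otimes\overline{\Phi}_n^C)(|\psi_n\rangle\langle\psi_n|)\in M_{k^2}(\mathbb C)$. Then, almost surely, the empirical eigenvalue distribution $k^{-2}\sum_{i=1}^{k^2}\delta_{\lambda_i(Z_n)}$ converges weakly as $n\to\infty$ to $$\frac1{k^2}\big[\delta_{\lambda_1}+(k^2-1)\delta_{\lambda_2}\big],\qquad \lambda_1=t|m|^2+\frac{1-t|m|^2}{k^2},\quad \lambda_2=\frac{1-t|m|^2}{k^2}.$$ Equivalently, for every integer $p\ge1$, $\operatorname{Tr}[Z_n^p]\to\lambda_1^p+(k^2-1)\lambda_2^p$ almost surely.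
   Context: Random channel model: for each $n$, let $U$ be a Haar-distributed unitary in $\mathcal U(nk)$, acting on $\mathbb C^k\otimes\mathbb C^n$, and let $V:\mathbb C^{tnk}\to\mathbb C^k\otimes\mathbb C^n$ be the isometry formed by the first $tnk$ columns of $U$. The channel is $\Phi_n(\rho)=\operatorname{Tr}_{\mathbb C^k}[V\rho V^*]\in M_n(\mathbb C)$ and its complementary channel is $\Phi_n^C(\rho)=\operatorname{Tr}_{\mathbb C^n}[V\rho V^*]\in M_k(\mathbb C)$. The conjugate channel $\overline\Phi_n$ (and $\overline\Phi_n^C$) is defined by the same formulas with $V$ replaced by its entrywise complex conjugate $\overline V$ (i.e. $U$ replaced by $\overline U$), using the same $U$. *)

theory Defs
  imports "HOL-Probability.Probability" "Jordan_Normal_Form.Char_Poly"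
begin

(* Square complex matrices of size N are modelled as functions  nat \<Rightarrow> nat \<Rightarrow> complex,
   only the entries with indices < N being relevant. *)
type_synonym cmat = "nat \<Rightarrow> nat \<Rightarrow> complex"

definition mat_space :: "nat \<Rightarrow> (nat \<times> nat \<Rightarrow> complex) measure" where
  "mat_space N = PiM ({..<N} \<times> {..<N}) (\<lambda>_. borel)"

definition pmat_mult :: "nat \<Rightarrow> (nat \<times> nat \<Rightarrow> complex) \<Rightarrow> (nat \<times> nat \<Rightarrow> complex) \<Rightarrow> (nat \<times> nat \<Rightarrow> complex)" where
  "pmat_mult N X Y = (\<lambda>(i,j)\<in>{..<N} \<times> {..<N}. \<Sum>l<N. X (i,l) * Y (l,j))"

definition is_unitary :: "nat \<Rightarrow> (nat \<times> nat \<Rightarrow> complex) \<Rightarrow> bool" where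
  "is_unitary N X \<longleftrightarrow>
     (\<forall>i<N. \<forall>j<N. (\<Sum>l<N. cnj (X (l,i)) * X (l,j)) = (if i = j then 1 else 0))"

definition haar_unitary :: "nat \<Rightarrow> (nat \<times> nat \<Rightarrow> complex) measure \<Rightarrow> bool" where
  "haar_unitary N \<mu> \<longleftrightarrow>
     prob_space \<mu> \<and> sets \<mu> = sets (mat_space N) \<and>
     (AE X in \<mu>. is_unitary N X) \<and>
     (\<forall>W \<in> space (mat_space N). is_unitary N W \<longrightarrow>
        distr \<mu> (mat_space N) (\<lambda>X. pmat_mult N W X) = \<mu>)"

(* isometry V : C^d \<rightarrow> C^k \<otimes> C^n formed by the first d columns of U *)
definition isom :: "(nat \<times> nat \<Rightarrow> complex) \<Rightarrow> cmat" where
  "isom U = (\<lambda>r c. U (r, c))"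

definition conjugate_by :: "nat \<Rightarrow> cmat \<Rightarrow> cmat \<Rightarrow> cmat" where
  "conjugate_by d V \<rho> = (\<lambda>r r'. \<Sum>i<d. \<Sum>j<d. V r i * \<rho> i j * cnj (V r' j))"

(* partial trace over the second factor of C^k \<otimes> C^n, basis |a>|b> \<mapsto> a*n+b *)
definition ptrace2 :: "nat \<Rightarrow> cmat \<Rightarrow> cmat" where
  "ptrace2 n X = (\<lambda>a a'. \<Sum>b<n. X (a*n+b) (a'*n+b))"

definition comp_channel :: "nat \<Rightarrow> nat \<Rightarrow> cmat \<Rightarrow> cmat \<Rightarrow> cmat" where
  "comp_channel n d V \<rho> = ptrace2 n (conjugate_by d V \<rho>)"

definition conj_isom :: "cmat \<Rightarrow> cmat" where
  "conj_isom V = (\<lambda>r c. cnj (V r c))"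

definition mat_unit :: "nat \<Rightarrow> nat \<Rightarrow> cmat" where
  "mat_unit i i' = (\<lambda>r c. if r = i \<and> c = i' then 1 else 0)"

(* (\<Phi> \<otimes> \<Psi>)(X) for \<Phi> : M_{d1} \<rightarrow> M_{k1}, \<Psi> : M_{d2} \<rightarrow> M_{k2}, X \<in> M_{d1 d2};
   tensor indices (i,j) \<mapsto> i*d2+j on the input, (a,c) \<mapsto> a*k2+c on the output *)
definition tensor_map :: "nat \<Rightarrow> nat \<Rightarrow> nat \<Rightarrow> (cmat \<Rightarrow> cmat) \<Rightarrow> (cmat \<Rightarrow> cmat) \<Rightarrow> cmat \<Rightarrow> cmat" where
  "tensor_map d1 d2 k2 \<Phi> \<Psi> X = (\<lambda>r r'.
     \<Sum>i<d1. \<Sum>j<d2. \<Sum>i'<d1. \<Sum>j'<d2.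
       X (i*d2+j) (i'*d2+j') * \<Phi> (mat_unit i i') (r div k2) (r' div k2)
                             * \<Psi> (mat_unit j j') (r mod k2) (r' mod k2))"

definition vec_of_mat :: "nat \<Rightarrow> cmat \<Rightarrow> (nat \<Rightarrow> complex)" where
  "vec_of_mat d A = (\<lambda>r. A (r div d) (r mod d))"

definition proj :: "(nat \<Rightarrow> complex) \<Rightarrow> cmat" where
  "proj \<psi> = (\<lambda>r r'. \<psi> r * cnj (\<psi> r'))"

definition Z_mat :: "nat \<Rightarrow> nat \<Rightarrow> nat \<Rightarrow> (nat \<times> nat \<Rightarrow> complex) \<Rightarrow> cmat \<Rightarrow> cmat" where
  "Z_mat k n d U A =
     tensor_map d d k (comp_channel n d (isom U)) (comp_channel n d (conj_isom (isom U)))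
       (proj (vec_of_mat d A))"

definition to_mat :: "nat \<Rightarrow> cmat \<Rightarrow> complex mat" where
  "to_mat N X = mat N N (\<lambda>(i,j). X i j)"

definition eigenvalues_mset :: "nat \<Rightarrow> cmat \<Rightarrow> complex multiset" where
  "eigenvalues_mset N X = proots (char_poly (to_mat N X))"

definition mtrace :: "nat \<Rightarrow> cmat \<Rightarrow> complex" where
  "mtrace d A = (\<Sum>i<d. A i i)"

definition cmat_mult :: "nat \<Rightarrow> cmat \<Rightarrow> cmat \<Rightarrow> cmat" where
  "cmat_mult N X Y = (\<lambda>i j. \<Sum>l<N. X i l * Y l j)"

definition cmat_id :: cmat where
  "cmat_id = (\<lambda>i j. if i = j then 1 else 0)"

definition cmat_pow :: "nat \<Rightarrow> cmat \<Rightarrow> nat \<Rightarrow> cmat" where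
  "cmat_pow N X p = ((\<lambda>Y. cmat_mult N Y X) ^^ p) cmat_id"

definition op_norm :: "nat \<Rightarrow> cmat \<Rightarrow> real" where
  "op_norm d A = Sup {sqrt (\<Sum>i<d. (cmod (\<Sum>j<d. A i j * x j))\<^sup>2) | x.
                        (\<Sum>j<d. (cmod (x j))\<^sup>2) \<le> 1}"

end

theory Submission
  imports Defs "HOL-Real_Asymp.Real_Asymp" "Jordan_Normal_Form.Schur_Decomposition"
begin

text \<open>Put \<open>N = n k\<close> and \<open>X = U A U\<^sup>*\<close>, with \<open>A\<close> padded by zeros to size \<open>N\<close>. Every entry of \<open>Z\<^sub>n\<close> is
  \<open>Tr (X Q X\<^sup>* P)\<close> for matrices \<open>P, Q\<close> of the form \<open>E\<^sub>a\<^sub>b \<otimes> I\<^sub>n\<close>. Left invariance of the Haar measure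
  under \<open>exp (s H)\<close> gives \<open>E (D\<^sub>H F) = 0\<close> for every polynomial \<open>F\<close> in the entries of \<open>X\<close> and \<open>X\<^sup>*\<close>, where
  \<open>D\<^sub>H\<close> is the derivation \<open>X \<mapsto> [H, X]\<close>. For \<open>K = X Q X\<^sup>* P\<close> the divergence \<open>\<Sum>\<^sub>i\<^sub>j D\<^sub>i\<^sub>j K\<^sub>i\<^sub>j\<close> equals
  \<open>N Tr (X Q X\<^sup>* P)\<close> plus products of traces linear in \<open>X\<close>, \<open>X\<^sup>*\<close> or \<open>X\<^sup>* X\<close>, which obey a similar but
  simpler identity. Testing against the conjugate of the centred entry yields a variance of order
  \<open>1 / N\<^sup>2\<close>, because \<open>\<parallel>X\<parallel> = O (N\<^sup>-\<^sup>1\<^sup>/\<^sup>2)\<close>. This is summable, so the entries converge almost surely, to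
  an explicit matrix \<open>\<alpha> J + \<lambda>\<^sub>2 I\<close> with \<open>J\<close> of rank one, and the eigenvalues follow.\<close>

(* These imported simp rules are sum.distrib in disguise. *)
declare class_semiring.finsum_addf [simp del] class_semiring.add.finprod_multf [simp del]

section \<open>Frobenius norm and operator bounds\<close>

text \<open>The centre \<open>f0\<close> is not the exact mean. It comes from the divergence
  identity by replacing each linear trace by its mean. Tested against the conjugate of
  \<open>f U - f0\<close>, the identity has leading term \<open>N\<close> times the squared modulus,
  so bias and fluctuation are bounded together, and no exact integral of a polynomial of degree four
  in \<open>U\<close> and its conjugate is computed. What is left is a gradient term, in which each
  factor holds one copy of \<open>X\<close> measured in operator norm and one in Frobenius norm, and
  products of traces with centred linear traces, which Young's inequality absorbs into half of the
  leading term. The one delicate product carries a trace of size \<open>N\<close> instead of sqrt N;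
  it multiplies the linear trace of \<open>X* X\<close>, whose Frobenius norm is smaller by the
  factor \<open>c\<close>. Left translation of \<open>U\<close> conjugates the orbit, so the
  one-sided invariance in \<open>haar_unitary\<close> is all that the derivation needs. The output
  has fixed size \<open>k\<^sup>2\<close>, so entrywise convergence carries all spectral
  information.\<close>

definition adj :: "cmat \<Rightarrow> cmat" where
  "adj X = (\<lambda>i j. cnj (X j i))"

definition frob :: "nat \<Rightarrow> cmat \<Rightarrow> real" where
  "frob N X = L2_set (\<lambda>(i,j). cmod (X i j)) ({..<N} \<times> {..<N})"

text \<open>A bound instead of the norm itself: constants pass through products, adjoints, padding
  and orbits without evaluating a supremum. \<open>op_bounded_op_norm\<close> links it to
  \<open>op_norm\<close>.\<close>

definition op_bounded :: "nat \<Rightarrow> cmat \<Rightarrow> real \<Rightarrow> bool" where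
  "op_bounded N X c \<longleftrightarrow> 0 \<le> c \<and>
     (\<forall>x. L2_set (\<lambda>i. cmod (\<Sum>j<N. X i j * x j)) {..<N} \<le> c * L2_set (\<lambda>j. cmod (x j)) {..<N})"

lemma cmat_mult_assoc: "cmat_mult N (cmat_mult N X Y) Z = cmat_mult N X (cmat_mult N Y Z)"
proof (intro ext)
  fix i j
  have "cmat_mult N (cmat_mult N X Y) Z i j = (\<Sum>l<N. \<Sum>p<N. X i p * Y p l * Z l j)"
    by (simp add: cmat_mult_def sum_distrib_right)
  also have "\<dots> = (\<Sum>p<N. \<Sum>l<N. X i p * Y p l * Z l j)"
    by (rule sum.swap)
  also have "\<dots> = cmat_mult N X (cmat_mult N Y Z) i j"
    by (simp add: cmat_mult_def sum_distrib_left mult.assoc)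
  finally show "cmat_mult N (cmat_mult N X Y) Z i j = cmat_mult N X (cmat_mult N Y Z) i j" .
qed

lemma cmat_mult_cong:
  assumes "\<And>l. l < N \<Longrightarrow> X i l = X' i l" "\<And>l. l < N \<Longrightarrow> Y l j = Y' l j"
  shows "cmat_mult N X Y i j = cmat_mult N X' Y' i j"
  using assms by (simp add: cmat_mult_def)

lemma cmat_mult_id_right: "j < N \<Longrightarrow> cmat_mult N X cmat_id i j = X i j"
  by (simp add: cmat_mult_def cmat_id_def if_distrib cong: if_cong)

lemma cmat_mult_id_left: "i < N \<Longrightarrow> cmat_mult N cmat_id X i j = X i j"
  by (simp add: cmat_mult_def cmat_id_def if_distrib[of "\<lambda>x. x * _"] cong: if_cong)

lemma mtrace_mult_comm: "mtrace N (cmat_mult N X Y) = mtrace N (cmat_mult N Y X)"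
  unfolding mtrace_def cmat_mult_def
  by (subst sum.swap) (simp add: mult.commute)

lemma mtrace_cong: "(\<And>i. i < N \<Longrightarrow> X i i = Y i i) \<Longrightarrow> mtrace N X = mtrace N Y"
  by (simp add: mtrace_def)

lemma adj_adj [simp]: "adj (adj X) = X"
  by (simp add: adj_def)

lemma adj_mult: "adj (cmat_mult N X Y) = cmat_mult N (adj Y) (adj X)"
  by (simp add: adj_def cmat_mult_def mult.commute)

lemma mtrace_adj: "mtrace N (adj X) = cnj (mtrace N X)"
  by (simp add: mtrace_def adj_def)

lemma frob_nonneg [simp]: "0 \<le> frob N X"
  by (simp add: frob_def)

lemma frob_square: "(frob N X)\<^sup>2 = (\<Sum>i<N. \<Sum>j<N. (cmod (X i j))\<^sup>2)"
  unfolding frob_def L2_set_def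
  by (subst real_sqrt_pow2) (auto intro!: sum_nonneg simp: sum.cartesian_product split_def)

lemma frob_cong: "(\<And>i j. i < N \<Longrightarrow> j < N \<Longrightarrow> X i j = Y i j) \<Longrightarrow> frob N X = frob N Y"
  unfolding frob_def by (intro L2_set_cong) auto

lemma frob_adj [simp]: "frob N (adj X) = frob N X"
proof -
  have "(frob N (adj X))\<^sup>2 = (frob N X)\<^sup>2"
    unfolding frob_square adj_def by (subst sum.swap) simp
  then show ?thesis by simp
qed

lemma frob_id: "frob N cmat_id = sqrt N"
proof -
  have "(frob N cmat_id)\<^sup>2 = real N"
    unfolding frob_square cmat_id_def by (simp add: if_distrib[of cmod] if_distrib[of "\<lambda>x. x\<^sup>2"] cong: if_cong)
  then show ?thesis by (metis abs_of_nonneg frob_nonneg real_sqrt_abs)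
qed

lemma entry_le_frob: "i < N \<Longrightarrow> j < N \<Longrightarrow> cmod (X i j) \<le> frob N X"
  unfolding frob_def
  using member_le_L2_set[of "{..<N} \<times> {..<N}" "(i,j)" "\<lambda>(i,j). cmod (X i j)"] by simp

lemma sum_mult_le_frob:
  "cmod (\<Sum>i<N. \<Sum>j<N. X i j * Y j i) \<le> frob N X * frob N Y"
proof -
  have "cmod (\<Sum>i<N. \<Sum>j<N. X i j * Y j i) = cmod (\<Sum>(i,j)\<in>{..<N}\<times>{..<N}. X i j * Y j i)"
    by (simp add: sum.cartesian_product)
  also have "\<dots> \<le> (\<Sum>(i,j)\<in>{..<N}\<times>{..<N}. \<bar>cmod (X i j)\<bar> * \<bar>cmod (adj Y i j)\<bar>)"
    by (rule order_trans[OF norm_sum]) (simp add: split_def norm_mult adj_def)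
  also have "\<dots> \<le> frob N X * frob N (adj Y)"
    unfolding frob_def
    using L2_set_mult_ineq[of "\<lambda>(i,j). cmod (X i j)" "\<lambda>(i,j). cmod (adj Y i j)" "{..<N}\<times>{..<N}"]
    by (simp add: split_def)
  finally show ?thesis by simp
qed

lemma mtrace_mult_le_frob: "cmod (mtrace N (cmat_mult N X Y)) \<le> frob N X * frob N Y"
  using sum_mult_le_frob[of X Y N] by (simp add: mtrace_def cmat_mult_def)

lemma mtrace_le_frob: "cmod (mtrace N X) \<le> frob N X * sqrt N"
proof -
  have "mtrace N X = mtrace N (cmat_mult N X cmat_id)"
    by (rule mtrace_cong) (simp add: cmat_mult_id_right)
  then show ?thesis using mtrace_mult_le_frob[of N X cmat_id] by (simp add: frob_id)
qed

lemma mtrace_adj_mult_self: "mtrace N (cmat_mult N (adj X) X) = complex_of_real ((frob N X)\<^sup>2)"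
  unfolding frob_square mtrace_def cmat_mult_def adj_def
  by (subst sum.swap) (simp add: mult.commute[of "cnj _"] complex_norm_square[symmetric] del: of_real_power)

lemma op_bounded_nonneg: "op_bounded N X c \<Longrightarrow> 0 \<le> c"
  by (simp add: op_bounded_def)

lemma op_boundedD:
  "op_bounded N X c \<Longrightarrow> L2_set (\<lambda>i. cmod (\<Sum>j<N. X i j * x j)) {..<N} \<le> c * L2_set (\<lambda>j. cmod (x j)) {..<N}"
  by (simp add: op_bounded_def)

lemma L2_set_square: "(L2_set f A)\<^sup>2 = (\<Sum>i\<in>A. (f i)\<^sup>2)"
  by (simp add: L2_set_def sum_nonneg)

lemma op_bounded_mult:
  assumes "op_bounded N X c" "op_bounded N Y c'"
  shows "op_bounded N (cmat_mult N X Y) (c * c')"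
  unfolding op_bounded_def
proof (intro conjI allI)
  show "0 \<le> c * c'" using assms by (simp add: op_bounded_def)
  fix x
  have "(\<Sum>j<N. cmat_mult N X Y i j * x j) = (\<Sum>j<N. X i j * (\<Sum>l<N. Y j l * x l))" for i
    unfolding cmat_mult_def sum_distrib_left sum_distrib_right
    by (subst sum.swap) (simp add: mult.assoc)
  then have "L2_set (\<lambda>i. cmod (\<Sum>j<N. cmat_mult N X Y i j * x j)) {..<N}
      \<le> c * L2_set (\<lambda>j. cmod (\<Sum>l<N. Y j l * x l)) {..<N}"
    using op_boundedD[OF assms(1), of "\<lambda>j. \<Sum>l<N. Y j l * x l"] by simp
  also have "\<dots> \<le> c * (c' * L2_set (\<lambda>j. cmod (x j)) {..<N})"
    using assms by (intro mult_left_mono op_boundedD) (auto simp: op_bounded_def)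
  finally show "L2_set (\<lambda>i. cmod (\<Sum>j<N. cmat_mult N X Y i j * x j)) {..<N}
      \<le> c * c' * L2_set (\<lambda>j. cmod (x j)) {..<N}" by (simp add: mult.assoc)
qed

text \<open>With y = X* x, the square of the norm of y is the inner product of X y with x, hence at
  most c |y| |x|. One factor |y| cancels.\<close>

lemma op_bounded_adj:
  assumes "op_bounded N X c"
  shows "op_bounded N (adj X) c"
  unfolding op_bounded_def
proof (intro conjI allI)
  show c: "0 \<le> c" using assms by (simp add: op_bounded_def)
  fix x
  define y where "y = (\<lambda>i. \<Sum>j<N. adj X i j * x j)"
  let ?n = "\<lambda>x. L2_set (\<lambda>j. cmod (x j)) {..<N}"
  have "complex_of_real ((?n y)\<^sup>2) = (\<Sum>i<N. cnj (y i) * y i)"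
    by (simp add: L2_set_square complex_norm_square mult.commute del: of_real_power)
  also have "\<dots> = (\<Sum>i<N. \<Sum>j<N. cnj (y i) * cnj (X j i) * x j)"
    by (subst (2) y_def) (simp add: adj_def sum_distrib_left mult.assoc)
  also have "\<dots> = (\<Sum>j<N. cnj (\<Sum>i<N. X j i * y i) * x j)"
    by (subst sum.swap) (simp add: sum_distrib_right sum_distrib_left mult_ac)
  finally have "(?n y)\<^sup>2 = cmod (\<Sum>j<N. cnj (\<Sum>i<N. X j i * y i) * x j)"
    by (metis abs_of_nonneg norm_of_real zero_le_power2)
  also have "\<dots> \<le> (\<Sum>j<N. \<bar>cmod (\<Sum>i<N. X j i * y i)\<bar> * \<bar>cmod (x j)\<bar>)"
    by (rule order_trans[OF norm_sum]) (simp add: norm_mult del: cnj_sum)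
  also have "\<dots> \<le> ?n (\<lambda>j. \<Sum>i<N. X j i * y i) * ?n x"
    by (rule L2_set_mult_ineq)
  also have "\<dots> \<le> c * ?n y * ?n x"
    by (intro mult_right_mono op_boundedD[OF assms]) simp
  finally have "?n y * ?n y \<le> c * ?n x * ?n y" by (simp add: power2_eq_square mult_ac)
  moreover have "0 \<le> c * ?n x" using c by simp
  ultimately have "?n y \<le> c * ?n x"
    by (metis L2_set_nonneg mult_right_le_imp_le order_le_less)
  then show "L2_set (\<lambda>i. cmod (\<Sum>j<N. adj X i j * x j)) {..<N} \<le> c * ?n x"
    by (simp add: y_def)
qed

text \<open>The squared Frobenius norm is the sum of the squared norms of the columns, and
  \<open>X\<close> acts on each column of \<open>Y\<close> separately.\<close>

lemma frob_mult_left: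
  assumes "op_bounded N X c"
  shows "frob N (cmat_mult N X Y) \<le> c * frob N Y"
proof (rule power2_le_imp_le)
  have "(frob N (cmat_mult N X Y))\<^sup>2 = (\<Sum>j<N. (L2_set (\<lambda>i. cmod (\<Sum>l<N. X i l * Y l j)) {..<N})\<^sup>2)"
    unfolding frob_square L2_set_square cmat_mult_def by (rule sum.swap)
  also have "\<dots> \<le> (\<Sum>j<N. (c * L2_set (\<lambda>l. cmod (Y l j)) {..<N})\<^sup>2)"
    by (intro sum_mono power_mono op_boundedD[OF assms]) simp
  also have "\<dots> = (c * frob N Y)\<^sup>2"
    unfolding power_mult_distrib frob_square L2_set_square sum_distrib_left by (rule sum.swap)
  finally show "(frob N (cmat_mult N X Y))\<^sup>2 \<le> (c * frob N Y)\<^sup>2" .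
  show "0 \<le> c * frob N Y" using assms by (simp add: op_bounded_def)
qed

lemma frob_mult_right:
  assumes "op_bounded N Q c"
  shows "frob N (cmat_mult N X Q) \<le> c * frob N X"
proof -
  have "frob N (cmat_mult N X Q) = frob N (cmat_mult N (adj Q) (adj X))"
    by (simp flip: adj_mult)
  then show ?thesis
    using frob_mult_left[OF op_bounded_adj[OF assms], of "adj X"] by simp
qed

lemma frob_le_op_bounded:
  assumes "op_bounded N P c" shows "frob N P \<le> c * sqrt N"
proof -
  have "frob N P = frob N (cmat_mult N P cmat_id)"
    by (rule frob_cong) (simp add: cmat_mult_id_right)
  then show ?thesis using frob_mult_left[OF assms, of cmat_id] by (simp add: frob_id)
qed

lemma mtrace_le_op_bounded:
  assumes "op_bounded N P c" shows "cmod (mtrace N P) \<le> c * N"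
proof -
  have "cmod (mtrace N P) \<le> frob N P * sqrt N" by (rule mtrace_le_frob)
  also have "\<dots> \<le> c * sqrt N * sqrt N"
    by (intro mult_right_mono frob_le_op_bounded[OF assms]) simp
  finally show ?thesis by (simp add: mult.assoc)
qed

section \<open>Unitary orbits\<close>

text \<open>Products run over all indices below \<open>N\<close>, so \<open>isom U\<close> stands
  here for the full unitary. The isometry of the channel reappears when \<open>T\<close> is a
  zero-padded matrix.\<close>

definition orbit :: "nat \<Rightarrow> cmat \<Rightarrow> (nat \<times> nat \<Rightarrow> complex) \<Rightarrow> cmat" where
  "orbit N T U = cmat_mult N (cmat_mult N (isom U) T) (adj (isom U))"

lemma orbit_expand: "orbit N T U a b = (\<Sum>i<N. \<Sum>j<N. U (a,i) * T i j * cnj (U (b,j)))"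
  unfolding orbit_def cmat_mult_def adj_def isom_def sum_distrib_right by (rule sum.swap)

lemma adj_orbit: "adj (orbit N T U) = orbit N (adj T) U"
  by (simp add: orbit_def adj_mult cmat_mult_assoc)

text \<open>Matrices are total functions, so U* U agrees with the identity only on indices below
  \<open>N\<close> and cannot be rewritten as an equation of functions. Inside a product only those
  entries are read, which restores an equality of functions.\<close>

lemma cmat_mult_cancel_middle:
  assumes "\<And>i j. i < N \<Longrightarrow> j < N \<Longrightarrow> J i j = cmat_id i j"
  shows "cmat_mult N Y (cmat_mult N J Z) = cmat_mult N Y Z"
proof (intro ext)
  fix i j
  have "cmat_mult N J Z l j = Z l j" if "l < N" for l
    using cmat_mult_cong[of N J l cmat_id Z j Z] assms that cmat_mult_id_left[of l N Z j] by simp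
  then show "cmat_mult N Y (cmat_mult N J Z) i j = cmat_mult N Y Z i j"
    by (intro cmat_mult_cong) auto
qed

lemma unitary_adj_mult:
  assumes "is_unitary N U" "i < N" "j < N"
  shows "cmat_mult N (adj (isom U)) (isom U) i j = cmat_id i j"
  using assms by (simp add: is_unitary_def cmat_mult_def adj_def isom_def cmat_id_def)

lemma unitary_op_bounded:
  assumes "is_unitary N U" shows "op_bounded N (isom U) 1"
  unfolding op_bounded_def
proof (intro conjI allI)
  fix x
  let ?y = "\<lambda>i. \<Sum>j<N. isom U i j * x j"
  have "complex_of_real ((L2_set (\<lambda>i. cmod (?y i)) {..<N})\<^sup>2) = (\<Sum>i<N. cnj (?y i) * ?y i)"
    by (simp add: L2_set_square complex_norm_square mult.commute del: of_real_power)
  also have "\<dots> = (\<Sum>i<N. \<Sum>j<N. \<Sum>l<N. cnj (x j) * (cnj (U (i,j)) * U (i,l)) * x l)"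
    unfolding cnj_sum sum_product by (simp add: isom_def mult_ac)
  also have "\<dots> = (\<Sum>j<N. \<Sum>l<N. \<Sum>i<N. cnj (x j) * (cnj (U (i,j)) * U (i,l)) * x l)"
    by (subst sum.swap, rule sum.cong[OF refl], rule sum.swap)
  also have "\<dots> = (\<Sum>j<N. \<Sum>l<N. cnj (x j) * (\<Sum>i<N. cnj (U (i,j)) * U (i,l)) * x l)"
    by (simp add: sum_distrib_left sum_distrib_right)
  also have "\<dots> = (\<Sum>j<N. \<Sum>l<N. if j = l then cnj (x j) * x l else 0)"
    using assms by (intro sum.cong refl) (auto simp: is_unitary_def)
  also have "\<dots> = complex_of_real ((L2_set (\<lambda>i. cmod (x i)) {..<N})\<^sup>2)"
    by (simp add: L2_set_square complex_norm_square mult.commute del: of_real_power)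
  finally have "(L2_set (\<lambda>i. cmod (?y i)) {..<N})\<^sup>2 = (L2_set (\<lambda>i. cmod (x i)) {..<N})\<^sup>2"
    using of_real_eq_iff by blast
  then show "L2_set (\<lambda>i. cmod (?y i)) {..<N} \<le> 1 * L2_set (\<lambda>i. cmod (x i)) {..<N}" by simp
qed simp

lemma orbit_mult:
  assumes "is_unitary N U"
  shows "cmat_mult N (orbit N S U) (orbit N T U) = orbit N (cmat_mult N S T) U"
  using cmat_mult_cancel_middle[where N = N and Y = S and Z = "cmat_mult N T (adj (isom U))", OF unitary_adj_mult[OF assms]]
  by (simp add: orbit_def cmat_mult_assoc)

lemma mtrace_orbit:
  assumes "is_unitary N U"
  shows "mtrace N (orbit N T U) = mtrace N T"
proof -
  have "mtrace N (orbit N T U) = mtrace N (cmat_mult N T (cmat_mult N (adj (isom U)) (isom U)))"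
    unfolding orbit_def cmat_mult_assoc by (subst mtrace_mult_comm) (simp add: cmat_mult_assoc)
  also have "\<dots> = mtrace N (cmat_mult N T cmat_id)"
    using unitary_adj_mult[OF assms] by (intro mtrace_cong cmat_mult_cong) auto
  also have "\<dots> = mtrace N T"
    by (rule mtrace_cong) (simp add: cmat_mult_id_right)
  finally show ?thesis .
qed

lemma frob_orbit_le:
  assumes "is_unitary N U" shows "frob N (orbit N T U) \<le> frob N T"
  using frob_mult_right[OF op_bounded_adj[OF unitary_op_bounded[OF assms]], of "cmat_mult N (isom U) T"]
    frob_mult_left[OF unitary_op_bounded[OF assms], of T]
  by (simp add: orbit_def)

lemma op_bounded_orbit:
  assumes "is_unitary N U" "op_bounded N T c" shows "op_bounded N (orbit N T U) c"
  using op_bounded_mult[OF op_bounded_mult[OF unitary_op_bounded assms(2)]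
      op_bounded_adj[OF unitary_op_bounded]] assms(1)
  by (simp add: orbit_def)

lemma isom_pmat_mult:
  "i < N \<Longrightarrow> j < N \<Longrightarrow> isom (pmat_mult N W U) i j = cmat_mult N (isom W) (isom U) i j"
  by (simp add: isom_def pmat_mult_def cmat_mult_def)

text \<open>Left translation by \<open>W\<close> turns X into W X W*. This is how the invariance of
  the measure becomes a statement about commutators with X.\<close>

lemma orbit_pmat_mult:
  assumes "a < N" "b < N"
  shows "orbit N T (pmat_mult N W U) a b = orbit N (orbit N T U) W a b"
proof -
  have "orbit N T (pmat_mult N W U) a b
      = cmat_mult N (cmat_mult N (cmat_mult N (isom W) (isom U)) T) (adj (cmat_mult N (isom W) (isom U))) a b"
    unfolding orbit_def using assms
    by (intro cmat_mult_cong) (auto simp: adj_def isom_pmat_mult)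
  then show ?thesis by (simp add: orbit_def adj_mult cmat_mult_assoc)
qed

lemma is_unitary_pmat_mult:
  assumes "is_unitary N W" "is_unitary N U"
  shows "is_unitary N (pmat_mult N W U)"
proof -
  have "cmat_mult N (adj (isom (pmat_mult N W U))) (isom (pmat_mult N W U)) i j = cmat_id i j"
    if "i < N" "j < N" for i j
  proof -
    have "cmat_mult N (adj (isom (pmat_mult N W U))) (isom (pmat_mult N W U)) i j
      = cmat_mult N (adj (cmat_mult N (isom W) (isom U))) (cmat_mult N (isom W) (isom U)) i j"
      using that by (intro cmat_mult_cong) (auto simp: adj_def isom_pmat_mult)
    also have "\<dots> = cmat_mult N (adj (isom U)) (cmat_mult N (cmat_mult N (adj (isom W)) (isom W)) (isom U)) i j"
      by (simp add: adj_mult cmat_mult_assoc)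
    also have "\<dots> = cmat_id i j"
      using that unitary_adj_mult[OF assms(2)]
      by (subst cmat_mult_cancel_middle[OF unitary_adj_mult[OF assms(1)]]) auto
    finally show ?thesis .
  qed
  then show ?thesis
    by (simp add: is_unitary_def cmat_mult_def adj_def isom_def cmat_id_def)
qed

section \<open>Differentiation under the Haar measure\<close>

definition rank_one_unitary :: "nat \<Rightarrow> (nat \<Rightarrow> complex) \<Rightarrow> complex \<Rightarrow> (nat \<times> nat \<Rightarrow> complex)" where
  "rank_one_unitary N v z =
     (\<lambda>(i,j)\<in>{..<N} \<times> {..<N}. cmat_id i j + (z - 1) * v i * cnj (v j))"

text \<open>On the unit circle the conjugate of z - 1 equals -(z - 1) up to an exact quadratic
  error, so first-order terms can be written in z - 1 alone.\<close>

lemma cnj_minus_one_unit: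
  assumes "cmod z = 1"
  shows "cnj (z - 1) = - (z - 1) - complex_of_real ((cmod (z - 1))\<^sup>2)"
proof -
  have "z * cnj z = 1" using assms complex_norm_square[of z] by simp
  then show ?thesis unfolding complex_norm_square by (simp add: algebra_simps)
qed

lemma sum_cmod_square_eq_1: "(\<Sum>i<N. (cmod (v i))\<^sup>2) = 1 \<Longrightarrow> (\<Sum>i<N. cnj (v i) * v i) = 1"
proof -
  assume a: "(\<Sum>i<N. (cmod (v i))\<^sup>2) = 1"
  have "(\<Sum>i<N. cnj (v i) * v i) = complex_of_real (\<Sum>i<N. (cmod (v i))\<^sup>2)"
    by (simp add: complex_norm_square mult.commute del: of_real_power)
  then show ?thesis by (simp add: a)
qed

lemma is_unitary_rank_one_unitary:
  assumes v: "(\<Sum>i<N. (cmod (v i))\<^sup>2) = 1" and z: "cmod z = 1"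
  shows "is_unitary N (rank_one_unitary N v z)"
  unfolding is_unitary_def
proof (intro allI impI)
  fix i j assume ij: "i < N" "j < N"
  let ?e = "z - 1"
  have "(\<Sum>l<N. cnj (rank_one_unitary N v z (l,i)) * rank_one_unitary N v z (l,j))
      = (\<Sum>l<N. (if l = i then cmat_id i j + ?e * v i * cnj (v j) else 0) +
           (if l = j then cnj ?e * cnj (v j) * v i else 0) + cnj ?e * ?e * v i * cnj (v j) * (cnj (v l) * v l))"
    using ij by (intro sum.cong refl) (auto simp: rank_one_unitary_def cmat_id_def algebra_simps)
  also have "\<dots> = cmat_id i j + ?e * v i * cnj (v j) + cnj ?e * cnj (v j) * v i + cnj ?e * ?e * v i * cnj (v j)"
    using ij sum_cmod_square_eq_1[OF v]
    by (simp add: sum.distrib flip: sum_distrib_left)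
  also have "\<dots> = cmat_id i j + (?e + cnj ?e + ?e * cnj ?e) * v i * cnj (v j)"
    by (simp add: algebra_simps)
  also have "?e + cnj ?e + ?e * cnj ?e = 0"
    using complex_norm_square[of z] z by (simp add: algebra_simps)
  finally show "(\<Sum>l<N. cnj (rank_one_unitary N v z (l,i)) * rank_one_unitary N v z (l,j)) =
      (if i = j then 1 else 0)" by (simp add: cmat_id_def)
qed

text \<open>An exact expansion, not a Taylor estimate: the coefficient of z - 1 is the entry of the
  commutator [v v*, T], and everything else carries the factor |z - 1|^2. This makes the remainder
  uniform.\<close>

lemma orbit_rank_one_unitary:
  assumes "a < N" "b < N" "cmod z = 1"
  shows "orbit N T (rank_one_unitary N v z) a b = T a b
      + (z - 1) * (v a * (\<Sum>j<N. cnj (v j) * T j b) - (\<Sum>i<N. T a i * v i) * cnj (v b))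
      + complex_of_real ((cmod (z - 1))\<^sup>2) *
         (v a * cnj (v b) * (\<Sum>i<N. \<Sum>j<N. cnj (v i) * T i j * v j) - (\<Sum>i<N. T a i * v i) * cnj (v b))"
proof -
  let ?e = "z - 1"
  have "orbit N T (rank_one_unitary N v z) a b =
     (\<Sum>i<N. \<Sum>j<N. (cmat_id a i + ?e * v a * cnj (v i)) * T i j * (cmat_id b j + cnj ?e * cnj (v b) * v j))"
    unfolding orbit_expand using assms
    by (intro sum.cong refl) (auto simp: rank_one_unitary_def cmat_id_def)
  also have "\<dots> = (\<Sum>i<N. \<Sum>j<N. (if j = b then (if i = a then T a b else 0) else 0)
       + (if j = b then ?e * v a * (cnj (v i) * T i b) else 0)
       + (if i = a then cnj ?e * cnj (v b) * (T a j * v j) else 0)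
       + ?e * cnj ?e * v a * cnj (v b) * (cnj (v i) * T i j * v j))"
    by (intro sum.cong refl) (auto simp: cmat_id_def algebra_simps)
  also have "\<dots> = T a b + ?e * v a * (\<Sum>i<N. cnj (v i) * T i b)
      + cnj ?e * cnj (v b) * (\<Sum>i<N. T a i * v i)
      + ?e * cnj ?e * v a * cnj (v b) * (\<Sum>i<N. \<Sum>j<N. cnj (v i) * T i j * v j)"
  proof -
    have s: "(\<Sum>i<N. \<Sum>j<N. if i = a then f j else 0) = (\<Sum>j<N. f j)" for f :: "nat \<Rightarrow> complex"
      using assms by (subst sum.swap) simp
    show ?thesis using assms by (simp add: sum.distrib s flip: sum_distrib_left)
  qed
  finally have eq: "orbit N T (rank_one_unitary N v z) a b = \<dots>" .
  \<comment> \<open>The product with the conjugate is rewritten before the lone conjugate, since the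
    latter also occurs inside it.\<close>
  have k1: "?e * cnj ?e = complex_of_real ((cmod ?e)\<^sup>2)"
    by (rule complex_norm_square[symmetric])
  show ?thesis
    unfolding eq k1 unfolding cnj_minus_one_unit[OF assms(3)] by (simp add: algebra_simps)
qed

text \<open>Supplies the points at which an upper bound proportional to |z - 1| forces a constant to
  be zero; a positive sine excludes z = 1.\<close>

lemma unit_circle_near_one:
  assumes "0 < \<delta>" obtains z where "cmod z = 1" "z \<noteq> 1" "cmod (z - 1) < \<delta>"
proof -
  have "((\<lambda>\<theta>. cis \<theta>) \<longlongrightarrow> cis 0) (at_right 0)"
    by (intro tendsto_intros)
  then have "\<forall>\<^sub>F \<theta> in at_right (0::real). dist (cis \<theta>) 1 < \<delta>"
    using assms by (auto dest: tendstoD)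
  moreover have "\<forall>\<^sub>F \<theta> in at_right (0::real). \<theta> \<in> {0<..<pi}"
    by (rule eventually_at_right_real) simp
  ultimately have "\<forall>\<^sub>F \<theta> in at_right (0::real). dist (cis \<theta>) 1 < \<delta> \<and> \<theta> \<in> {0<..<pi}"
    by eventually_elim simp
  then obtain \<theta> where "dist (cis \<theta>) 1 < \<delta>" "0 < \<theta>" "\<theta> < pi"
    using eventually_happens'[OF trivial_limit_at_right_real] by fastforce
  moreover from this have "sin \<theta> > 0" by (simp add: sin_gt_zero)
  then have "cis \<theta> \<noteq> 1" by (auto simp: complex_eq_iff)
  ultimately show ?thesis using that[of "cis \<theta>"] by (simp add: dist_norm)
qed

locale haar_measure =
  fixes N :: nat and \<mu> :: "(nat \<times> nat \<Rightarrow> complex) measure"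
  assumes haar: "haar_unitary N \<mu>"
begin

sublocale prob_space \<mu>
  using haar by (simp add: haar_unitary_def)

lemma sets_mu: "sets \<mu> = sets (mat_space N)"
  using haar by (simp add: haar_unitary_def)

lemma AE_unitary: "AE U in \<mu>. is_unitary N U"
  using haar by (simp add: haar_unitary_def)

lemma left_invariant:
  "W \<in> space (mat_space N) \<Longrightarrow> is_unitary N W \<Longrightarrow> distr \<mu> (mat_space N) (pmat_mult N W) = \<mu>"
  using haar by (simp add: haar_unitary_def)

lemma measurable_entry [measurable]: "i < N \<Longrightarrow> j < N \<Longrightarrow> (\<lambda>U. U (i,j)) \<in> borel_measurable \<mu>"
  unfolding measurable_cong_sets[OF sets_mu refl] mat_space_def
  by (rule measurable_component_singleton) auto

lemma measurable_pmat_mult: "pmat_mult N W \<in> measurable \<mu> (mat_space N)"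
  unfolding mat_space_def pmat_mult_def[abs_def]
proof (rule measurable_PiM_single')
  show "(\<lambda>Y. \<lambda>(i, j)\<in>{..<N} \<times> {..<N}. \<Sum>l<N. W (i, l) * Y (l, j))
     \<in> space \<mu> \<rightarrow> (\<Pi>\<^sub>E i\<in>{..<N} \<times> {..<N}. space borel)" by auto
  fix x assume "x \<in> {..<N} \<times> {..<N}"
  then show "(\<lambda>Y. (\<lambda>(i, j)\<in>{..<N} \<times> {..<N}. \<Sum>l<N. W (i, l) * Y (l, j)) x) \<in> borel_measurable \<mu>"
    by (cases x) (auto intro!: borel_measurable_sum borel_measurable_times measurable_entry)
qed

lemma measurable_orbit [measurable]: "a < N \<Longrightarrow> b < N \<Longrightarrow> (\<lambda>U. orbit N T U a b) \<in> borel_measurable \<mu>"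
  unfolding orbit_expand
  by (intro borel_measurable_sum borel_measurable_times borel_measurable_const measurable_entry
      borel_measurable_continuous_on[of cnj] continuous_on_cnj continuous_on_id) auto

lemma integrable_bounded_unitary:
  fixes F :: "_ \<Rightarrow> 'b::{banach, second_countable_topology}"
  assumes "F \<in> borel_measurable \<mu>" "\<And>U. is_unitary N U \<Longrightarrow> norm (F U) \<le> B"
  shows "integrable \<mu> F"
  using assms AE_unitary by (intro integrable_const_bound[where B = B]) auto

lemma integral_left_invariant:
  fixes F :: "_ \<Rightarrow> complex"
  assumes "F \<in> borel_measurable \<mu>" "W \<in> space (mat_space N)" "is_unitary N W"
  shows "(\<integral>U. F (pmat_mult N W U) \<partial>\<mu>) = (\<integral>U. F U \<partial>\<mu>)"
proof -
  have "F \<in> borel_measurable (mat_space N)"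
    using assms(1) by (simp add: measurable_cong_sets[OF sets_mu refl])
  from integral_distr[OF measurable_pmat_mult this, of W] show ?thesis
    by (simp add: left_invariant[OF assms(2,3)])
qed

text \<open>\<open>G i j\<close> is the derivative of \<open>F\<close> along the direction \<open>E\<^sub>i\<^sub>j\<close>, tested only
  on the one-parameter groups generated by rank-one projections \<open>v v\<^sup>*\<close>; these span all matrices.
  The uniform second-order remainder replaces differentiation under the integral sign.\<close>

definition lie_deriv :: "((nat \<times> nat \<Rightarrow> complex) \<Rightarrow> complex) \<Rightarrow> (nat \<Rightarrow> nat \<Rightarrow> (nat \<times> nat \<Rightarrow> complex) \<Rightarrow> complex) \<Rightarrow> bool" where
  "lie_deriv F G \<longleftrightarrow>
     F \<in> borel_measurable \<mu> \<and> (\<forall>i<N. \<forall>j<N. G i j \<in> borel_measurable \<mu>) \<and>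
     (\<exists>B. \<forall>U. is_unitary N U \<longrightarrow> cmod (F U) \<le> B \<and> (\<forall>i<N. \<forall>j<N. cmod (G i j U) \<le> B)) \<and>
     (\<exists>C. \<forall>U v z. is_unitary N U \<longrightarrow> (\<Sum>i<N. (cmod (v i))\<^sup>2) = 1 \<longrightarrow> cmod z = 1 \<longrightarrow>
        cmod (F (pmat_mult N (rank_one_unitary N v z) U) - F U
              - (z - 1) * (\<Sum>i<N. \<Sum>j<N. v i * cnj (v j) * G i j U)) \<le> C * (cmod (z - 1))\<^sup>2)"

lemma lie_derivI:
  assumes "F \<in> borel_measurable \<mu>" "\<And>i j. i < N \<Longrightarrow> j < N \<Longrightarrow> G i j \<in> borel_measurable \<mu>"
    and "\<And>U. is_unitary N U \<Longrightarrow> cmod (F U) \<le> B"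
    and "\<And>U i j. is_unitary N U \<Longrightarrow> i < N \<Longrightarrow> j < N \<Longrightarrow> cmod (G i j U) \<le> B"
    and "\<And>U v z. is_unitary N U \<Longrightarrow> (\<Sum>i<N. (cmod (v i))\<^sup>2) = 1 \<Longrightarrow> cmod z = 1 \<Longrightarrow>
        cmod (F (pmat_mult N (rank_one_unitary N v z) U) - F U
              - (z - 1) * (\<Sum>i<N. \<Sum>j<N. v i * cnj (v j) * G i j U)) \<le> C * (cmod (z - 1))\<^sup>2"
  shows "lie_deriv F G"
  using assms unfolding lie_deriv_def by blast

lemma unit_entry_le:
  assumes "(\<Sum>i<N. (cmod (v i))\<^sup>2) = 1" "i < N" shows "cmod (v i) \<le> 1"
proof -
  have "(cmod (v i))\<^sup>2 \<le> (\<Sum>i<N. (cmod (v i))\<^sup>2)"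
    using assms(2) by (intro member_le_sum) auto
  then show ?thesis using assms(1) by (simp add: abs_square_le_1 power2_le_imp_le)
qed

lemma sesquilinear_le:
  assumes v: "(\<Sum>i<N. (cmod (v i))\<^sup>2) = 1" and G: "\<And>i j. i < N \<Longrightarrow> j < N \<Longrightarrow> cmod (G i j) \<le> B"
  shows "cmod (\<Sum>i<N. \<Sum>j<N. v i * cnj (v j) * G i j) \<le> real N * (real N * B)"
proof -
  have "cmod (v i * cnj (v j) * G i j) \<le> B" if "i < N" "j < N" for i j
  proof -
    have "cmod (v i) * cmod (v j) * cmod (G i j) \<le> 1 * 1 * B"
      using unit_entry_le[OF v] that G by (intro mult_mono) auto
    then show ?thesis by (simp add: norm_mult)
  qed
  then have "cmod (\<Sum>j<N. v i * cnj (v j) * G i j) \<le> real (card {..<N}) * B" if "i < N" for i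
    using that by (intro sum_norm_bound) auto
  then have "cmod (\<Sum>i<N. \<Sum>j<N. v i * cnj (v j) * G i j) \<le> real (card {..<N}) * (real N * B)"
    by (intro sum_norm_bound) auto
  then show ?thesis by simp
qed

lemma lie_deriv_cong:
  assumes "lie_deriv F G" "\<And>i j U. i < N \<Longrightarrow> j < N \<Longrightarrow> G i j U = G' i j U"
  shows "lie_deriv F G'"
proof -
  have "G i j = G' i j" if "i < N" "j < N" for i j
    using assms(2) that by auto
  moreover from this have "(\<Sum>i<N. \<Sum>j<N. v i * cnj (v j) * G i j U) = (\<Sum>i<N. \<Sum>j<N. v i * cnj (v j) * G' i j U)" for v U
    by (intro sum.cong refl) auto
  ultimately show ?thesis using assms(1) unfolding lie_deriv_def by simp
qed

lemma lie_deriv_measurable: "lie_deriv F G \<Longrightarrow> F \<in> borel_measurable \<mu>"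
  and lie_deriv_measurable': "lie_deriv F G \<Longrightarrow> i < N \<Longrightarrow> j < N \<Longrightarrow> G i j \<in> borel_measurable \<mu>"
  by (auto simp: lie_deriv_def)

lemma lie_deriv_integrable: "lie_deriv F G \<Longrightarrow> integrable \<mu> F"
  unfolding lie_deriv_def using integrable_bounded_unitary[of F] by blast

lemma lie_deriv_integrable': "lie_deriv F G \<Longrightarrow> i < N \<Longrightarrow> j < N \<Longrightarrow> integrable \<mu> (G i j)"
  unfolding lie_deriv_def using integrable_bounded_unitary[of "G i j"] by blast

section \<open>Calculus of derivations: constants, sums, products, entries of the orbit\<close>

lemma lie_deriv_const: "lie_deriv (\<lambda>U. c) (\<lambda>i j U. 0)"
  by (rule lie_derivI[where B = "cmod c" and C = 0]) auto

lemma lie_deriv_add: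
  assumes "lie_deriv F G" "lie_deriv F' G'"
  shows "lie_deriv (\<lambda>U. F U + F' U) (\<lambda>i j U. G i j U + G' i j U)"
proof -
  obtain B where B: "\<And>U. is_unitary N U \<Longrightarrow> cmod (F U) \<le> B"
    "\<And>U i j. is_unitary N U \<Longrightarrow> i < N \<Longrightarrow> j < N \<Longrightarrow> cmod (G i j U) \<le> B"
    using assms(1) unfolding lie_deriv_def by blast
  obtain B' where B': "\<And>U. is_unitary N U \<Longrightarrow> cmod (F' U) \<le> B'"
    "\<And>U i j. is_unitary N U \<Longrightarrow> i < N \<Longrightarrow> j < N \<Longrightarrow> cmod (G' i j U) \<le> B'"
    using assms(2) unfolding lie_deriv_def by blast
  let ?R = "\<lambda>F G U v z. F (pmat_mult N (rank_one_unitary N v z) U) - F U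
              - (z - 1) * (\<Sum>i<N. \<Sum>j<N. v i * cnj (v j) * G i j U)"
  obtain C where C: "\<And>U v z. is_unitary N U \<Longrightarrow> (\<Sum>i<N. (cmod (v i))\<^sup>2) = 1 \<Longrightarrow> cmod z = 1 \<Longrightarrow>
        cmod (?R F G U v z) \<le> C * (cmod (z - 1))\<^sup>2"
    using assms(1) unfolding lie_deriv_def by blast
  obtain C' where C': "\<And>U v z. is_unitary N U \<Longrightarrow> (\<Sum>i<N. (cmod (v i))\<^sup>2) = 1 \<Longrightarrow> cmod z = 1 \<Longrightarrow>
        cmod (?R F' G' U v z) \<le> C' * (cmod (z - 1))\<^sup>2"
    using assms(2) unfolding lie_deriv_def by blast
  show ?thesis 
  proof (rule lie_derivI[where B = "B + B'" and C = "C + C'"])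
    fix U v z assume a: "is_unitary N U" "(\<Sum>i<N. (cmod (v i))\<^sup>2) = 1" "cmod z = 1"
    have "?R (\<lambda>U. F U + F' U) (\<lambda>i j U. G i j U + G' i j U) U v z = ?R F G U v z + ?R F' G' U v z"
      by (simp add: algebra_simps sum.distrib)
    then show "cmod (?R (\<lambda>U. F U + F' U) (\<lambda>i j U. G i j U + G' i j U) U v z) \<le> (C + C') * (cmod (z - 1))\<^sup>2"
      using norm_triangle_mono[OF C[OF a] C'[OF a]] by (simp only: distrib_right)
  qed (auto intro!: norm_triangle_mono B B' borel_measurable_add lie_deriv_measurable[OF assms(1)]
      lie_deriv_measurable[OF assms(2)] lie_deriv_measurable'[OF assms(1)] lie_deriv_measurable'[OF assms(2)])
qed

lemma lie_deriv_mult: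
  assumes "lie_deriv F G" "lie_deriv F' G'"
  shows "lie_deriv (\<lambda>U. F U * F' U) (\<lambda>i j U. G i j U * F' U + F U * G' i j U)"
proof -
  obtain B0 where B0: "\<And>U. is_unitary N U \<Longrightarrow> cmod (F U) \<le> B0"
    "\<And>U i j. is_unitary N U \<Longrightarrow> i < N \<Longrightarrow> j < N \<Longrightarrow> cmod (G i j U) \<le> B0"
    using assms(1) unfolding lie_deriv_def by blast
  obtain B1 where B1: "\<And>U. is_unitary N U \<Longrightarrow> cmod (F' U) \<le> B1"
    "\<And>U i j. is_unitary N U \<Longrightarrow> i < N \<Longrightarrow> j < N \<Longrightarrow> cmod (G' i j U) \<le> B1"
    using assms(2) unfolding lie_deriv_def by blast
  \<comment> \<open>The existential bounds come without a sign; the maximum with 0 makes them usable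
    in products. The same is done for the remainder constants below.\<close>
  define B where "B = max 0 (max B0 B1)"
  have B: "0 \<le> B" "\<And>U. is_unitary N U \<Longrightarrow> cmod (F U) \<le> B"
    "\<And>U i j. is_unitary N U \<Longrightarrow> i < N \<Longrightarrow> j < N \<Longrightarrow> cmod (G i j U) \<le> B"
    "\<And>U. is_unitary N U \<Longrightarrow> cmod (F' U) \<le> B"
    "\<And>U i j. is_unitary N U \<Longrightarrow> i < N \<Longrightarrow> j < N \<Longrightarrow> cmod (G' i j U) \<le> B"
    using B0 B1 by (auto simp: B_def le_max_iff_disj)
  let ?g = "\<lambda>G U v. \<Sum>i<N. \<Sum>j<N. v i * cnj (v j) * G i j U"
  let ?R = "\<lambda>F G U v z. F (pmat_mult N (rank_one_unitary N v z) U) - F U - (z - 1) * ?g G U v"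
  obtain C0 where C0: "\<And>U v z. is_unitary N U \<Longrightarrow> (\<Sum>i<N. (cmod (v i))\<^sup>2) = 1 \<Longrightarrow> cmod z = 1 \<Longrightarrow>
        cmod (?R F G U v z) \<le> C0 * (cmod (z - 1))\<^sup>2"
    using assms(1) unfolding lie_deriv_def by blast
  obtain C1 where C1: "\<And>U v z. is_unitary N U \<Longrightarrow> (\<Sum>i<N. (cmod (v i))\<^sup>2) = 1 \<Longrightarrow> cmod z = 1 \<Longrightarrow>
        cmod (?R F' G' U v z) \<le> C1 * (cmod (z - 1))\<^sup>2"
    using assms(2) unfolding lie_deriv_def by blast
  define C where "C = max 0 (max C0 C1)"
  have C: "cmod (?R F G U v z) \<le> C * (cmod (z - 1))\<^sup>2" "cmod (?R F' G' U v z) \<le> C * (cmod (z - 1))\<^sup>2"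
    if "is_unitary N U" "(\<Sum>i<N. (cmod (v i))\<^sup>2) = 1" "cmod z = 1" for U v z
    using order_trans[OF C0[OF that] mult_right_mono[of C0 C]] order_trans[OF C1[OF that] mult_right_mono[of C1 C]]
    by (auto simp: C_def)
  define D where "D = real N * (real N * B)"
  have D: "0 \<le> D" using B(1) by (simp add: D_def)
  have C_nonneg: "0 \<le> C" by (simp add: C_def)
  show ?thesis 
  proof (rule lie_derivI[where B = "2 * B * B + B * B" and C = "D * D + C * B + (B + 2 * D) * C"])
    fix U v z assume a: "is_unitary N U" "(\<Sum>i<N. (cmod (v i))\<^sup>2) = 1" "cmod z = 1"
    let ?e = "z - 1"
    let ?W = "pmat_mult N (rank_one_unitary N v z) U"
    have W: "is_unitary N ?W"
      using a by (intro is_unitary_pmat_mult is_unitary_rank_one_unitary)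
    have gg: "?g (\<lambda>i j U. G i j U * F' U + F U * G' i j U) U v = ?g G U v * F' U + F U * ?g G' U v"
      by (simp add: algebra_simps sum.distrib sum_distrib_left)
    \<comment> \<open>In this splitting the first remainder is multiplied by the translated value
      \<open>F' ?W\<close>, which is bounded because \<open>?W\<close> is again unitary. No product
      of the two remainders appears.\<close>
    have e: "?R (\<lambda>U. F U * F' U) (\<lambda>i j U. G i j U * F' U + F U * G' i j U) U v z
       = ?e * ?e * (?g G U v * ?g G' U v) + ?R F G U v z * F' ?W + (F U + ?e * ?g G U v) * ?R F' G' U v z"
      unfolding gg by (simp only: algebra_simps)
    have g1: "cmod (?g G U v) \<le> D" and g2: "cmod (?g G' U v) \<le> D"
      unfolding D_def using a(1) by (auto intro!: sesquilinear_le[OF a(2)] B)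
    have e2: "cmod ?e \<le> 2" using norm_triangle_ineq4[of z 1] a(3) by simp
    let ?E = "(cmod ?e)\<^sup>2"
    have t1: "cmod (?e * ?e * (?g G U v * ?g G' U v)) \<le> ?E * (D * D)"
      unfolding norm_mult power2_eq_square using g1 g2 D by (intro mult_mono) auto
    have t2: "cmod (?R F G U v z * F' ?W) \<le> C * ?E * B"
      unfolding norm_mult using C(1)[OF a] B(4)[OF W] C_nonneg by (intro mult_mono) auto
    have "cmod (F U + ?e * ?g G U v) \<le> B + 2 * D"
      unfolding norm_mult using B(2)[OF a(1)] g1 D e2
      by (intro norm_triangle_mono) (auto simp: norm_mult intro!: mult_mono)
    then have t3: "cmod ((F U + ?e * ?g G U v) * ?R F' G' U v z) \<le> (B + 2 * D) * (C * ?E)"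
      unfolding norm_mult using C(2)[OF a] B(1) D by (intro mult_mono) auto
    show "cmod (?R (\<lambda>U. F U * F' U) (\<lambda>i j U. G i j U * F' U + F U * G' i j U) U v z)
       \<le> (D * D + C * B + (B + 2 * D) * C) * ?E"
      unfolding e by (rule order_trans[OF norm_triangle_mono[OF norm_triangle_mono[OF t1 t2] t3]])
        (simp add: algebra_simps)
  next
    fix U assume U: "is_unitary N U"
    have "cmod (F U) * cmod (F' U) \<le> B * B" using B U by (intro mult_mono) auto
    also have "\<dots> \<le> 2 * B * B + B * B" using B(1) by simp
    finally show "cmod (F U * F' U) \<le> 2 * B * B + B * B" by (simp add: norm_mult)
    fix i j assume ij: "i < N" "j < N"
    have "cmod (G i j U * F' U + F U * G' i j U) \<le> B * B + B * B"
      using B U ij by (intro norm_triangle_mono) (auto simp: norm_mult intro!: mult_mono)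
    also have "\<dots> \<le> 2 * B * B + B * B" using B(1) by simp
    finally show "cmod (G i j U * F' U + F U * G' i j U) \<le> 2 * B * B + B * B" .
  qed (auto intro!: borel_measurable_add borel_measurable_times lie_deriv_measurable[OF assms(1)]
      lie_deriv_measurable[OF assms(2)] lie_deriv_measurable'[OF assms(1)] lie_deriv_measurable'[OF assms(2)])
qed

lemma lie_deriv_sum:
  assumes "finite I" "\<And>x. x \<in> I \<Longrightarrow> lie_deriv (F x) (G x)"
  shows "lie_deriv (\<lambda>U. \<Sum>x\<in>I. F x U) (\<lambda>i j U. \<Sum>x\<in>I. G x i j U)"
  using assms by (induction I rule: finite_induct) (auto intro: lie_deriv_const lie_deriv_add)

text \<open>The derivative is the entry (a, b) of the commutator [E_ij, X]. The Frobenius norm of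
  \<open>T\<close> bounds every entry along the whole orbit, so the remainder constant does not
  depend on \<open>U\<close>, v or z.\<close>

lemma lie_deriv_orbit:
  assumes ab: "a < N" "b < N"
  shows "lie_deriv (\<lambda>U. orbit N T U a b)
     (\<lambda>i j U. (if a = i then orbit N T U j b else 0) - (if j = b then orbit N T U a i else 0))"
    (is "lie_deriv ?F ?G")
proof (rule lie_derivI[where B = "frob N T + frob N T" and C = "real N * (real N * frob N T) + real N * frob N T"])
  fix U assume U: "is_unitary N U"
  have B: "cmod (orbit N T U i j) \<le> frob N T" if "i < N" "j < N" for i j
    using entry_le_frob[OF that] frob_orbit_le[OF U] by (rule order_trans)
  show "cmod (?F U) \<le> frob N T + frob N T" using B[OF ab] frob_nonneg[of N T] by linarith
  show "cmod (?G i j U) \<le> frob N T + frob N T" if "i < N" "j < N" for i j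
    using B that ab by (intro order_trans[OF norm_triangle_ineq4] add_mono) auto
  fix v z assume v: "(\<Sum>i<N. (cmod (v i))\<^sup>2) = 1" and z: "cmod z = 1"
  let ?T = "orbit N T U"
  have "(\<Sum>i<N. \<Sum>j<N. v i * cnj (v j) * ?G i j U)
     = (\<Sum>i<N. \<Sum>j<N. (if i = a then v a * (cnj (v j) * ?T j b) else 0) - (if j = b then ?T a i * v i * cnj (v b) else 0))"
    by (intro sum.cong refl) (auto simp: algebra_simps)
  also have "\<dots> = v a * (\<Sum>j<N. cnj (v j) * ?T j b) - (\<Sum>i<N. ?T a i * v i) * cnj (v b)"
  proof -
    have s: "(\<Sum>i<N. \<Sum>j<N. if i = a then f j else 0) = (\<Sum>j<N. f j)" for f :: "nat \<Rightarrow> complex"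
      using assms by (subst sum.swap) simp
    show ?thesis using assms by (simp add: sum_subtractf s sum_distrib_left sum_distrib_right)
  qed
  finally have "?F (pmat_mult N (rank_one_unitary N v z) U) - ?F U -
      (z - 1) * (\<Sum>i<N. \<Sum>j<N. v i * cnj (v j) * ?G i j U)
     = complex_of_real ((cmod (z - 1))\<^sup>2) *
        (v a * cnj (v b) * (\<Sum>i<N. \<Sum>j<N. cnj (v i) * ?T i j * v j) - (\<Sum>i<N. ?T a i * v i) * cnj (v b))"
    using ab z by (simp add: orbit_pmat_mult orbit_rank_one_unitary)
  moreover have "cmod (v a * cnj (v b) * (\<Sum>i<N. \<Sum>j<N. cnj (v i) * ?T i j * v j) - (\<Sum>i<N. ?T a i * v i) * cnj (v b))
     \<le> real N * (real N * frob N T) + real N * frob N T"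
  proof (rule order_trans[OF norm_triangle_ineq4 add_mono])
    have "cmod (\<Sum>i<N. \<Sum>j<N. cnj (v i) * ?T i j * v j) \<le> real N * (real N * frob N T)"
      using sesquilinear_le[of "\<lambda>i. cnj (v i)" ?T "frob N T"] v B by (simp add: mult_ac)
    then have "cmod (v a) * cmod (v b) * cmod (\<Sum>i<N. \<Sum>j<N. cnj (v i) * ?T i j * v j) \<le> 1 * 1 * (real N * (real N * frob N T))"
      using unit_entry_le[OF v] ab by (intro mult_mono) auto
    then show "cmod (v a * cnj (v b) * (\<Sum>i<N. \<Sum>j<N. cnj (v i) * ?T i j * v j)) \<le> real N * (real N * frob N T)"
      by (simp add: norm_mult)
    have "cmod (?T a i * v i) \<le> frob N T * 1" if "i < N" for i
      unfolding norm_mult using unit_entry_le[OF v] ab that B by (intro mult_mono) auto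
    then have "cmod (\<Sum>i<N. ?T a i * v i) \<le> real (card {..<N}) * (frob N T * 1)"
      by (intro sum_norm_bound) auto
    then have "cmod (\<Sum>i<N. ?T a i * v i) * cmod (v b) \<le> (real N * frob N T) * 1"
      using unit_entry_le[OF v] ab by (intro mult_mono) auto
    then show "cmod ((\<Sum>i<N. ?T a i * v i) * cnj (v b)) \<le> real N * frob N T" by (simp add: norm_mult)
  qed
  ultimately show "cmod (?F (pmat_mult N (rank_one_unitary N v z) U) - ?F U -
      (z - 1) * (\<Sum>i<N. \<Sum>j<N. v i * cnj (v j) * ?G i j U))
     \<le> (real N * (real N * frob N T) + real N * frob N T) * (cmod (z - 1))\<^sup>2"
    by (simp add: norm_mult norm_power mult.commute mult_left_mono)
qed (use ab in auto)

text \<open>Invariance makes the integral of the increment of \<open>F\<close> vanish, so the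
  integrated first-order term (z - 1) c is at most C |z - 1|^2. Dividing by |z - 1| and letting z
  tend to 1 gives c = 0.\<close>

lemma integral_lie_deriv_unit:
  assumes F: "lie_deriv F G" and v: "(\<Sum>i<N. (cmod (v i))\<^sup>2) = 1"
  shows "(\<Sum>i<N. \<Sum>j<N. v i * cnj (v j) * (\<integral>U. G i j U \<partial>\<mu>)) = 0"
proof -
  let ?g = "\<lambda>U. \<Sum>i<N. \<Sum>j<N. v i * cnj (v j) * G i j U"
  define c where "c = (\<Sum>i<N. \<Sum>j<N. v i * cnj (v j) * (\<integral>U. G i j U \<partial>\<mu>))"
  have ig: "integrable \<mu> ?g"
    using lie_deriv_integrable'[OF F] by (intro Bochner_Integration.integrable_sum integrable_mult_right) auto
  have c: "c = (\<integral>U. ?g U \<partial>\<mu>)"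
    unfolding c_def using lie_deriv_integrable'[OF F]
    by (subst Bochner_Integration.integral_sum, force intro!: Bochner_Integration.integrable_sum integrable_mult_right)
       (intro sum.cong refl, subst Bochner_Integration.integral_sum, auto intro!: integrable_mult_right)
  obtain C where C: "\<And>U z. is_unitary N U \<Longrightarrow> cmod z = 1 \<Longrightarrow>
        cmod (F (pmat_mult N (rank_one_unitary N v z) U) - F U - (z - 1) * ?g U) \<le> C * (cmod (z - 1))\<^sup>2"
    using F v unfolding lie_deriv_def by blast
  have le: "cmod c \<le> C * cmod (z - 1)" if z: "cmod z = 1" "z \<noteq> 1" for z
  proof -
    let ?W = "rank_one_unitary N v z"
    have W: "?W \<in> space (mat_space N)" "is_unitary N ?W"
      using v z is_unitary_rank_one_unitary[OF v, of z] by (auto simp: mat_space_def space_PiM rank_one_unitary_def)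
    have FW: "integrable \<mu> (\<lambda>U. F (pmat_mult N ?W U))"
    proof -
      have m: "F \<in> borel_measurable (mat_space N)"
        using lie_deriv_measurable[OF F] by (simp add: measurable_cong_sets[OF sets_mu refl])
      then have "integrable (distr \<mu> (mat_space N) (pmat_mult N ?W)) F"
        using lie_deriv_integrable[OF F] left_invariant[OF W] by simp
      then show ?thesis using integrable_distr_eq[OF measurable_pmat_mult m] by simp
    qed
    have "(\<integral>U. F (pmat_mult N ?W U) - F U - (z - 1) * ?g U \<partial>\<mu>) = - ((z - 1) * c)"
      using FW lie_deriv_integrable[OF F] ig integral_left_invariant[OF lie_deriv_measurable[OF F] W]
      by (simp add: c)
    moreover have "cmod (\<integral>U. F (pmat_mult N ?W U) - F U - (z - 1) * ?g U \<partial>\<mu>)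
        \<le> (\<integral>U. C * (cmod (z - 1))\<^sup>2 \<partial>\<mu>)"
      using AE_unitary C[OF _ z(1)] FW lie_deriv_integrable[OF F] ig
      by (intro order_trans[OF integral_norm_bound] integral_mono_AE) auto
    ultimately have "cmod (z - 1) * cmod c \<le> C * (cmod (z - 1))\<^sup>2"
      by (simp add: norm_mult prob_space)
    moreover have "0 < cmod (z - 1)" using z by simp
    ultimately show ?thesis by (simp add: power2_eq_square mult_le_cancel_left_pos mult_ac)
  qed
  have "c = 0"
  proof (rule ccontr)
    assume "c \<noteq> 0"
    then have pos: "0 < cmod c / (\<bar>C\<bar> + 1)" by (simp add: add_nonneg_pos)
    obtain z where z: "cmod z = 1" "z \<noteq> 1" "cmod (z - 1) < cmod c / (\<bar>C\<bar> + 1)"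
      using unit_circle_near_one[OF pos] by blast
    have "cmod c \<le> C * cmod (z - 1)" by (rule le[OF z(1,2)])
    also have "\<dots> \<le> (\<bar>C\<bar> + 1) * cmod (z - 1)" by (intro mult_right_mono) auto
    also have "\<dots> < cmod c" using z(3) by (simp add: pos_less_divide_eq add_nonneg_pos mult.commute)
    finally show False by simp
  qed
  then show ?thesis by (simp add: c_def)
qed

text \<open>Polarisation: a complex matrix whose sesquilinear form vanishes on all unit vectors is
  zero. Here the matrix consists of the integrals of the \<open>G i j\<close>.\<close>

theorem integral_lie_deriv:
  assumes F: "lie_deriv F G" and ij: "p < N" "q < N"
  shows "(\<integral>U. G p q U \<partial>\<mu>) = 0"
proof -
  define M where "M = (\<lambda>i j. \<integral>U. G i j U \<partial>\<mu>)"
  have M: "(\<Sum>i<N. \<Sum>j<N. v i * cnj (v j) * M i j) = 0" if "(\<Sum>i<N. (cmod (v i))\<^sup>2) = 1" for v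
    using integral_lie_deriv_unit[OF F that] by (simp add: M_def)
  have diag: "M i i = 0" if "i < N" for i
  proof -
    let ?v = "\<lambda>l. if l = i then 1 else 0 :: complex"
    have "(\<Sum>a<N. \<Sum>b<N. ?v a * cnj (?v b) * M a b) = (\<Sum>a<N. \<Sum>b<N. if b = i then (if a = i then M i i else 0) else 0)"
      by (intro sum.cong refl) auto
    also have "\<dots> = M i i" using that by simp
    finally show ?thesis using M[of ?v] that by (simp add: if_distrib[of cmod] if_distrib[of "\<lambda>x. x\<^sup>2"] cong: if_cong)
  qed
  have off: "cnj w * M p q + w * M q p = 0" if "p \<noteq> q" "cmod w = 1" for w
  proof -
    let ?s = "complex_of_real (1 / sqrt 2)"
    \<comment> \<open>The unit vector (e_p + w e_q) / sqrt 2. Once the diagonal is known to vanish,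
      the phases w = 1 and w = \<i> give \<open>M p q + M q p = 0\<close> and
      \<open>M p q = M q p\<close>.\<close>
    let ?v = "\<lambda>l. (if l = p then ?s else 0) + (if l = q then ?s * w else 0)"
    have s: "?s * ?s = 1 / 2" by (simp flip: of_real_mult)
    have n: "(\<Sum>i<N. (cmod (?v i))\<^sup>2) = (\<Sum>i<N. (if i = p then 1/2 else 0) + (if i = q then 1/2 else 0))"
      using that by (intro sum.cong refl) (auto simp: norm_mult power_mult_distrib norm_divide power_divide)
    have ww: "w * cnj w = 1" using that complex_norm_square[of w] by simp
    have "(\<Sum>a<N. \<Sum>b<N. ?v a * cnj (?v b) * M a b) =
       (\<Sum>a<N. \<Sum>b<N. (if b = p then (if a = p then ?s * ?s * M p p else 0) else 0)
          + (if b = q then (if a = p then ?s * ?s * cnj w * M p q else 0) else 0)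
          + (if b = p then (if a = q then ?s * ?s * w * M q p else 0) else 0)
          + (if b = q then (if a = q then ?s * ?s * (w * cnj w) * M q q else 0) else 0))"
      using that by (intro sum.cong refl) auto
    also have "\<dots> = ?s * ?s * M p p + ?s * ?s * cnj w * M p q + ?s * ?s * w * M q p + ?s * ?s * (w * cnj w) * M q q"
      using ij by (simp add: sum.distrib)
    also have "\<dots> = 1 / 2 * (cnj w * M p q + w * M q p)"
      unfolding s ww using diag ij by (simp add: algebra_simps)
    finally show ?thesis using M[of ?v] n ij by (simp add: sum.distrib)
  qed
  show ?thesis
  proof (cases "p = q")
    case True then show ?thesis using diag ij by (simp add: M_def)
  next
    case False
    have 1: "M p q + M q p = 0" using off[OF False, of 1] by simp
    have "\<i> * (M q p - M p q) = 0" using off[OF False, of \<i>] by (simp add: algebra_simps)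
    then have "M p q = M q p" by simp
    then show ?thesis using 1 by (simp add: M_def)
  qed
qed

end

section \<open>Variances of traces\<close>

text \<open>Dictionary: \<open>F\<close>, \<open>H1\<close>, \<open>H2\<close> are the traces of X Q
  X* P, X* P Q and X* X Q; \<open>u\<close>, \<open>v\<close> those of X Q and X* P;
  \<open>\<tau>\<close>, \<open>s\<close>, \<open>p\<close>, \<open>q\<close>, \<open>pq\<close>
  those of T, T*, P, Q and P Q. The right side centres each linear trace at its mean, splitting u v
  one factor at a time. The mean q / n of \<open>H2\<close> reflects that T* T has trace 1.\<close>

lemma quadratic_divergence_identity:
  fixes n :: complex
  assumes "n \<noteq> 0"
  shows "n * F - \<tau> * H1 + u * v - H2 * p =
    n * (F - (\<tau> * s * pq / n - \<tau> * s * q * p / (n * n) + q * p / n) / n)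
     - (\<tau> * (H1 - s * pq / n) - ((u - \<tau> * q / n) * v + \<tau> * q / n * (v - s * p / n)) + p * (H2 - q / n))"
  using assms by (simp add: divide_simps) (simp add: algebra_simps)

lemma sum4_square_le:
  fixes a b c d :: real
  shows "(a + (b + c) + d)\<^sup>2 \<le> 4 * (a\<^sup>2 + b\<^sup>2 + c\<^sup>2 + d\<^sup>2)"
proof -
  have "4 * (a\<^sup>2 + b\<^sup>2 + c\<^sup>2 + d\<^sup>2) - (a + (b + c) + d)\<^sup>2
      = (a - b)\<^sup>2 + (a - c)\<^sup>2 + (a - d)\<^sup>2 + (b - c)\<^sup>2 + (b - d)\<^sup>2 + (c - d)\<^sup>2"
    by (simp add: power2_eq_square algebra_simps)
  also have "\<dots> \<ge> 0" by simp
  finally show ?thesis by simp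
qed

context haar_measure
begin

section \<open>Derivatives of linear and quadratic traces, and integration by parts\<close>

lemma lie_deriv_integrable_square:
  assumes "lie_deriv F G" shows "integrable \<mu> (\<lambda>U. (cmod (F U))\<^sup>2)"
proof -
  obtain B where B: "\<And>U. is_unitary N U \<Longrightarrow> cmod (F U) \<le> B"
    using assms unfolding lie_deriv_def by blast
  show ?thesis
    using lie_deriv_measurable[OF assms] B
    by (intro integrable_bounded_unitary[where B = "B\<^sup>2"]) (auto intro!: power_mono)
qed

lemma lie_deriv_cmult_right: "lie_deriv F G \<Longrightarrow> lie_deriv (\<lambda>U. F U * c) (\<lambda>i j U. G i j U * c)"
  using lie_deriv_mult[OF _ lie_deriv_const[of c]] by simp

lemma lie_deriv_diff_const: "lie_deriv F G \<Longrightarrow> lie_deriv (\<lambda>U. F U - c) G"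
  using lie_deriv_add[OF _ lie_deriv_const[of "- c"]] by simp

lemma lie_deriv_orbit_mult:
  assumes "a < N"
  shows "lie_deriv (\<lambda>U. cmat_mult N (orbit N T U) Q a l)
     (\<lambda>i j U. (if a = i then cmat_mult N (orbit N T U) Q j l else 0) - orbit N T U a i * Q j l)"
proof -
  have "lie_deriv (\<lambda>U. \<Sum>x<N. orbit N T U a x * Q x l)
     (\<lambda>i j U. \<Sum>x<N. ((if a = i then orbit N T U j x else 0) - (if j = x then orbit N T U a i else 0)) * Q x l)"
    using assms by (intro lie_deriv_sum lie_deriv_cmult_right lie_deriv_orbit) auto
  then show ?thesis
    unfolding cmat_mult_def
    by (rule lie_deriv_cong)
      (auto simp: left_diff_distrib sum_subtractf if_distrib[of "\<lambda>x. x * _"] cong: if_cong)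
qed

text \<open>By cyclicity the trace of [E_ij, X] Q is the trace of E_ij (X Q - Q X), which is the
  entry (j, i); hence the swapped indices.\<close>

lemma lie_deriv_mtrace_orbit_mult:
  "lie_deriv (\<lambda>U. mtrace N (cmat_mult N (orbit N T U) Q))
     (\<lambda>i j U. cmat_mult N (orbit N T U) Q j i - cmat_mult N Q (orbit N T U) j i)"
proof -
  have "lie_deriv (\<lambda>U. \<Sum>a<N. cmat_mult N (orbit N T U) Q a a)
     (\<lambda>i j U. \<Sum>a<N. (if a = i then cmat_mult N (orbit N T U) Q j a else 0) - orbit N T U a i * Q j a)"
    by (intro lie_deriv_sum lie_deriv_orbit_mult) auto
  then show ?thesis
    unfolding mtrace_def
    by (rule lie_deriv_cong) (simp add: sum_subtractf, simp add: cmat_mult_def mult.commute)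
qed

text \<open>The four terms are E_ij inserted on the left and, with a minus sign, on the right of
  each of the two orbit factors.\<close>

lemma lie_deriv_quadratic:
  assumes "a < N"
  shows "lie_deriv (\<lambda>U. cmat_mult N (cmat_mult N (orbit N S U) Q) (cmat_mult N (orbit N T U) P) a l)
     (\<lambda>i j U. (if a = i then cmat_mult N (cmat_mult N (orbit N S U) Q) (cmat_mult N (orbit N T U) P) j l else 0)
        - orbit N S U a i * cmat_mult N Q (cmat_mult N (orbit N T U) P) j l
        + cmat_mult N (orbit N S U) Q a i * cmat_mult N (orbit N T U) P j l
        - cmat_mult N (cmat_mult N (orbit N S U) Q) (orbit N T U) a i * P j l)"
proof -
  let ?X = "\<lambda>U. cmat_mult N (orbit N S U) Q" and ?Y = "\<lambda>U. cmat_mult N (orbit N T U) P"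
  have D: "lie_deriv (\<lambda>U. \<Sum>p<N. ?X U a p * ?Y U p l)
     (\<lambda>i j U. \<Sum>p<N. ((if a = i then ?X U j p else 0) - orbit N S U a i * Q j p) * ?Y U p l
        + ?X U a p * ((if p = i then ?Y U j l else 0) - orbit N T U p i * P j l))"
    using assms by (intro lie_deriv_sum lie_deriv_mult lie_deriv_orbit_mult) auto
  have "(\<Sum>p<N. ((if a = i then ?X U j p else 0) - orbit N S U a i * Q j p) * ?Y U p l
        + ?X U a p * ((if p = i then ?Y U j l else 0) - orbit N T U p i * P j l))
     = (if a = i then cmat_mult N (?X U) (?Y U) j l else 0) - orbit N S U a i * cmat_mult N Q (?Y U) j l
        + ?X U a i * ?Y U j l - cmat_mult N (?X U) (orbit N T U) a i * P j l" if "i < N" for i j U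
  proof -
    have "(\<Sum>p<N. ((if a = i then ?X U j p else 0) - orbit N S U a i * Q j p) * ?Y U p l
        + ?X U a p * ((if p = i then ?Y U j l else 0) - orbit N T U p i * P j l))
      = (\<Sum>p<N. (if a = i then ?X U j p * ?Y U p l else 0) - orbit N S U a i * (Q j p * ?Y U p l)
         + (if p = i then ?X U a i * ?Y U j l else 0) - (?X U a p * orbit N T U p i) * P j l)"
      by (intro sum.cong refl) (auto simp: algebra_simps)
    also have "\<dots> = (\<Sum>p<N. (if a = i then ?X U j p * ?Y U p l else 0)) - orbit N S U a i * (\<Sum>p<N. Q j p * ?Y U p l)
         + ?X U a i * ?Y U j l - (\<Sum>p<N. ?X U a p * orbit N T U p i) * P j l"
      using that by (simp add: sum.distrib sum_subtractf sum_distrib_left sum_distrib_right)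
    finally show ?thesis
      by (simp add: cmat_mult_def[of N "?X U" "?Y U"] cmat_mult_def[of N Q] cmat_mult_def[of N "?X U" "orbit N T U"])
  qed
  from lie_deriv_cong[OF D this] show ?thesis
    unfolding cmat_mult_def[of N "?X _" "?Y _"] by simp
qed

lemma lie_deriv_mtrace_quadratic:
  "lie_deriv (\<lambda>U. mtrace N (cmat_mult N (cmat_mult N (orbit N S U) Q) (cmat_mult N (orbit N T U) P)))
     (\<lambda>i j U. cmat_mult N (cmat_mult N (orbit N S U) Q) (cmat_mult N (orbit N T U) P) j i
        - cmat_mult N (cmat_mult N Q (cmat_mult N (orbit N T U) P)) (orbit N S U) j i
        + cmat_mult N (cmat_mult N (orbit N T U) P) (cmat_mult N (orbit N S U) Q) j i
        - cmat_mult N P (cmat_mult N (cmat_mult N (orbit N S U) Q) (orbit N T U)) j i)"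
  unfolding mtrace_def
proof (rule lie_deriv_cong[OF lie_deriv_sum[OF _ lie_deriv_quadratic]])
  fix i j U assume "i < N" "j < N"
  then show "(\<Sum>x<N. (if x = i then cmat_mult N (cmat_mult N (orbit N S U) Q) (cmat_mult N (orbit N T U) P) j x else 0) -
           orbit N S U x i * cmat_mult N Q (cmat_mult N (orbit N T U) P) j x +
           cmat_mult N (orbit N S U) Q x i * cmat_mult N (orbit N T U) P j x -
           cmat_mult N (cmat_mult N (orbit N S U) Q) (orbit N T U) x i * P j x)
     = cmat_mult N (cmat_mult N (orbit N S U) Q) (cmat_mult N (orbit N T U) P) j i
        - cmat_mult N (cmat_mult N Q (cmat_mult N (orbit N T U) P)) (orbit N S U) j i
        + cmat_mult N (cmat_mult N (orbit N T U) P) (cmat_mult N (orbit N S U) Q) j i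
        - cmat_mult N P (cmat_mult N (cmat_mult N (orbit N S U) Q) (orbit N T U)) j i"
    unfolding cmat_mult_def[of N "cmat_mult N Q _"] cmat_mult_def[of N "cmat_mult N (orbit N T U) P"] cmat_mult_def[of N P]
    by (simp add: sum_subtractf sum.distrib mult.commute)
qed auto

text \<open>Integration by parts with test function \<open>g\<close>: the Leibniz rule for
  \<open>K U i j * g U\<close> in direction E_ij, summed over i and j. The first two indices of
  \<open>D\<close> name the entry of \<open>K\<close>, the last two the direction.\<close>

lemma integral_divergence:
  assumes K: "\<And>i j. i < N \<Longrightarrow> j < N \<Longrightarrow> lie_deriv (\<lambda>U. K U i j) (D i j)"
    and g: "lie_deriv g G"
  shows "integrable \<mu> (\<lambda>U. \<Sum>i<N. \<Sum>j<N. D i j i j U * g U + K U i j * G i j U)"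
    and "(\<integral>U. (\<Sum>i<N. \<Sum>j<N. D i j i j U * g U + K U i j * G i j U) \<partial>\<mu>) = 0"
proof -
  have L: "lie_deriv (\<lambda>U. K U i j * g U) (\<lambda>a b U. D i j a b U * g U + K U i j * G a b U)" if "i < N" "j < N" for i j
    using K[OF that] g by (rule lie_deriv_mult)
  have I: "integrable \<mu> (\<lambda>U. D i j i j U * g U + K U i j * G i j U)"
    and Z: "(\<integral>U. D i j i j U * g U + K U i j * G i j U \<partial>\<mu>) = 0" if "i < N" "j < N" for i j
    using lie_deriv_integrable'[OF L[OF that] that] integral_lie_deriv[OF L[OF that] that] by auto
  have I': "integrable \<mu> (\<lambda>U. \<Sum>j<N. D i j i j U * g U + K U i j * G i j U)" if "i < N" for i
    by (rule Bochner_Integration.integrable_sum) (use I that in auto)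
  show "integrable \<mu> (\<lambda>U. \<Sum>i<N. \<Sum>j<N. D i j i j U * g U + K U i j * G i j U)"
    by (rule Bochner_Integration.integrable_sum) (use I' in auto)
  show "(\<integral>U. (\<Sum>i<N. \<Sum>j<N. D i j i j U * g U + K U i j * G i j U) \<partial>\<mu>) = 0"
    using I' I Z by (simp add: Bochner_Integration.integral_sum)
qed

text \<open>For K = X Q the divergence is N Tr (X Q) - Tr X Tr Q, and Tr X is constant on the orbit,
  so it is exactly \<open>N\<close> times the centred trace. Against the conjugate, only the
  gradient term remains: two pairings of matrices of Frobenius norm at most that of
  \<open>T\<close>.\<close>

lemma variance_linear:
  assumes N: "0 < N" and Q: "op_bounded N Q 1"
  shows "integrable \<mu> (\<lambda>U. (cmod (mtrace N (cmat_mult N (orbit N T U) Q) - mtrace N T * mtrace N Q / N))\<^sup>2)"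
    and "(\<integral>U. (cmod (mtrace N (cmat_mult N (orbit N T U) Q) - mtrace N T * mtrace N Q / N))\<^sup>2 \<partial>\<mu>)
      \<le> 2 * (frob N T)\<^sup>2 / N"
proof -
  define c where "c = mtrace N T * mtrace N Q / N"
  let ?T = "\<lambda>U. orbit N T U" and ?T' = "\<lambda>U. orbit N (adj T) U"
  let ?\<Delta> = "\<lambda>U. mtrace N (cmat_mult N (?T U) Q) - c"
  \<comment> \<open>The complex derivation does not commute with conjugation, so the conjugate is
    rewritten as a trace over the orbit of \<open>adj T\<close>, where the rules above
    apply.\<close>
  define g where "g = (\<lambda>U. mtrace N (cmat_mult N (?T' U) (adj Q)) - cnj c)"
  have g: "g U = cnj (?\<Delta> U)" for U
  proof -
    have "mtrace N (cmat_mult N (?T' U) (adj Q)) = mtrace N (adj (cmat_mult N Q (?T U)))"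
      by (simp add: adj_mult adj_orbit)
    then show ?thesis by (simp add: g_def mtrace_adj mtrace_mult_comm[of N Q])
  qed
  let ?G = "\<lambda>i j U. cmat_mult N (?T' U) (adj Q) j i - cmat_mult N (adj Q) (?T' U) j i"
  have Lg: "lie_deriv g ?G"
    unfolding g_def by (intro lie_deriv_diff_const lie_deriv_mtrace_orbit_mult)
  show int: "integrable \<mu> (\<lambda>U. (cmod (?\<Delta> U))\<^sup>2)"
    using lie_deriv_integrable_square[OF Lg] by (simp only: g complex_mod_cnj)
  let ?K = "\<lambda>U i j. cmat_mult N (?T U) Q i j"
  let ?D = "\<lambda>a l i j U. (if a = i then cmat_mult N (?T U) Q j l else 0) - ?T U a i * Q j l"
  define \<Phi> where "\<Phi> = (\<lambda>U. \<Sum>i<N. \<Sum>j<N. ?D i j i j U * g U + ?K U i j * ?G i j U)"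
  have \<Phi>: "integrable \<mu> \<Phi>" "(\<integral>U. \<Phi> U \<partial>\<mu>) = 0"
    unfolding \<Phi>_def using integral_divergence[where K = ?K and D = ?D, OF lie_deriv_orbit_mult Lg] by auto
  have bound: "real N * (cmod (?\<Delta> U))\<^sup>2 \<le> 2 * (frob N T)\<^sup>2 + Re (\<Phi> U)" if U: "is_unitary N U" for U
  proof -
    define R where "R = (\<Sum>i<N. \<Sum>j<N. ?K U i j * ?G i j U)"
    have \<Phi>_eq: "\<Phi> U = (\<Sum>i<N. \<Sum>j<N. ?D i j i j U) * g U + R"
      by (simp only: \<Phi>_def R_def sum.distrib sum_distrib_right)
    have "(\<Sum>i<N. \<Sum>j<N. ?D i j i j U) = of_nat N * mtrace N (cmat_mult N (?T U) Q) - mtrace N (?T U) * mtrace N Q"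
      by (simp add: sum_subtractf mtrace_def sum_product)
    also have "\<dots> = of_nat N * ?\<Delta> U"
      using N by (simp add: mtrace_orbit[OF U] c_def field_simps)
    finally have "\<Phi> U = of_nat N * ?\<Delta> U * g U + R" unfolding \<Phi>_eq by (rule arg_cong)
    also have "of_nat N * ?\<Delta> U * g U = complex_of_real (real N * (cmod (?\<Delta> U))\<^sup>2)"
      by (simp add: g complex_norm_square del: of_real_power complex_cnj_diff)
    finally have "real N * (cmod (?\<Delta> U))\<^sup>2 = Re (\<Phi> U) - Re R" by simp
    moreover have "cmod R \<le> 2 * (frob N T)\<^sup>2"
    proof -
      have t: "frob N (?T U) \<le> frob N T" "frob N (?T' U) \<le> frob N T"
        using frob_orbit_le[OF U, of T] frob_orbit_le[OF U, of "adj T"] by auto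
      have f: "frob N (cmat_mult N (?T U) Q) \<le> frob N T"
        "frob N (cmat_mult N (?T' U) (adj Q)) \<le> frob N T" "frob N (cmat_mult N (adj Q) (?T' U)) \<le> frob N T"
        using frob_mult_right[OF Q, of "?T U"] frob_mult_right[OF op_bounded_adj[OF Q], of "?T' U"]
          frob_mult_left[OF op_bounded_adj[OF Q], of "?T' U"] t by linarith+
      have Req: "R = (\<Sum>i<N. \<Sum>j<N. ?K U i j * cmat_mult N (?T' U) (adj Q) j i)
          - (\<Sum>i<N. \<Sum>j<N. ?K U i j * cmat_mult N (adj Q) (?T' U) j i)"
        by (simp only: R_def right_diff_distrib sum_subtractf)
      have "cmod R \<le> frob N (?K U) * frob N (cmat_mult N (?T' U) (adj Q))
          + frob N (?K U) * frob N (cmat_mult N (adj Q) (?T' U))"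
        unfolding Req by (intro order_trans[OF norm_triangle_ineq4] add_mono sum_mult_le_frob)
      also have "\<dots> \<le> frob N T * frob N T + frob N T * frob N T"
        using add_mono[OF mult_mono[OF f(1,2)] mult_mono[OF f(1,3)]] by simp
      finally show ?thesis unfolding power2_eq_square by linarith
    qed
    ultimately show ?thesis using complex_Re_le_cmod[of "- R"] by simp
  qed
  have "(\<integral>U. real N * (cmod (?\<Delta> U))\<^sup>2 \<partial>\<mu>) \<le> (\<integral>U. 2 * (frob N T)\<^sup>2 + Re (\<Phi> U) \<partial>\<mu>)"
    using AE_unitary bound int \<Phi>(1) by (intro integral_mono_AE) auto
  also have "\<dots> = 2 * (frob N T)\<^sup>2"
    using \<Phi> by (simp add: prob_space)
  finally show "(\<integral>U. (cmod (?\<Delta> U))\<^sup>2 \<partial>\<mu>) \<le> 2 * (frob N T)\<^sup>2 / N"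
    using N by (simp add: field_simps)
qed

text \<open>After half of the leading term is absorbed, the integral is bounded by 2 / N times 4 c^2
  + (2 / N) (2 + 2 + 2 + 2 N c^2): the gradient gives the first term, the four centred linear traces
  the others. This is the source of 24 and 16.\<close>

lemma variance_quadratic:
  assumes N: "0 < N" and P: "op_bounded N P 1" and Q: "op_bounded N Q 1"
    and T: "op_bounded N T c" and T1: "frob N T = 1"
  defines "f \<equiv> \<lambda>U. mtrace N (cmat_mult N (cmat_mult N (orbit N T U) Q) (cmat_mult N (orbit N (adj T) U) P))"
    and "f0 \<equiv> (mtrace N T * cnj (mtrace N T) * mtrace N (cmat_mult N P Q) / N
         - mtrace N T * cnj (mtrace N T) * mtrace N Q * mtrace N P / (N * N)
         + mtrace N Q * mtrace N P / N) / N"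
  shows "integrable \<mu> (\<lambda>U. (cmod (f U - f0))\<^sup>2)"
    and "(\<integral>U. (cmod (f U - f0))\<^sup>2 \<partial>\<mu>) \<le> 24 / (real N)\<^sup>2 + 16 * c\<^sup>2 / N"
proof -
  let ?X = "\<lambda>U. orbit N T U" and ?Y = "\<lambda>U. orbit N (adj T) U"
  let ?m = "cmat_mult N"
  let ?\<tau> = "mtrace N T"
  let ?\<Delta> = "\<lambda>U. f U - f0"
  note Pa = op_bounded_adj[OF P] and Qa = op_bounded_adj[OF Q] and Ta = op_bounded_adj[OF T]
  have c0: "0 \<le> c" using T by (rule op_bounded_nonneg)
  \<comment> \<open>The adjoint of X Q X* P is P* X Q* X*, cyclically again a quadratic trace of the
    same shape with \<open>adj Q\<close> and \<open>adj P\<close>. So the same derivative formula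
    serves for \<open>g\<close>.\<close>
  define g where "g = (\<lambda>U. mtrace N (?m (?m (?X U) (adj Q)) (?m (?Y U) (adj P))) - cnj f0)"
  have g: "g U = cnj (?\<Delta> U)" for U
  proof -
    have "cnj (f U) = mtrace N (adj (?m (?m (?X U) Q) (?m (?Y U) P)))"
      by (simp add: f_def mtrace_adj)
    also have "\<dots> = mtrace N (?m (adj P) (?m (?X U) (?m (adj Q) (?Y U))))"
      by (simp add: adj_mult adj_orbit cmat_mult_assoc)
    also have "\<dots> = mtrace N (?m (?m (?X U) (adj Q)) (?m (?Y U) (adj P)))"
      by (subst mtrace_mult_comm) (simp add: cmat_mult_assoc)
    finally show ?thesis by (simp add: g_def)
  qed
  let ?G = "\<lambda>i j U. ?m (?m (?X U) (adj Q)) (?m (?Y U) (adj P)) j i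
        - ?m (?m (adj Q) (?m (?Y U) (adj P))) (?X U) j i
        + ?m (?m (?Y U) (adj P)) (?m (?X U) (adj Q)) j i
        - ?m (adj P) (?m (?m (?X U) (adj Q)) (?Y U)) j i"
  have Lg: "lie_deriv g ?G"
    unfolding g_def by (intro lie_deriv_diff_const lie_deriv_mtrace_quadratic)
  show int: "integrable \<mu> (\<lambda>U. (cmod (?\<Delta> U))\<^sup>2)"
    using lie_deriv_integrable_square[OF Lg] by (simp only: g complex_mod_cnj)
  let ?K = "\<lambda>U i j. ?m (?m (?X U) Q) (?m (?Y U) P) i j"
  let ?D = "\<lambda>a l i j U. (if a = i then ?K U j l else 0)
        - ?X U a i * ?m Q (?m (?Y U) P) j l + ?m (?X U) Q a i * ?m (?Y U) P j l
        - ?m (?m (?X U) Q) (?Y U) a i * P j l"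
  define \<Phi> where "\<Phi> = (\<lambda>U. \<Sum>i<N. \<Sum>j<N. ?D i j i j U * g U + ?K U i j * ?G i j U)"
  have \<Phi>: "integrable \<mu> \<Phi>" "(\<integral>U. \<Phi> U \<partial>\<mu>) = 0"
    unfolding \<Phi>_def using integral_divergence[where K = ?K and D = ?D, OF lie_deriv_quadratic Lg] by auto
  \<comment> \<open>The centred linear traces of the divergence. In \<open>h2\<close> the product X*
    X is itself the orbit of T* T, whose Frobenius norm is at most \<open>c\<close>; this smaller
    variance pays for its coefficient \<open>mtrace N P\<close>, which may be as large as
    \<open>N\<close>.\<close>
  define h1 where "h1 = (\<lambda>U. mtrace N (?m (?Y U) (?m P Q)) - mtrace N (adj T) * mtrace N (?m P Q) / N)"
  define u where "u = (\<lambda>U. mtrace N (?m (?X U) Q) - ?\<tau> * mtrace N Q / N)"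
  define v where "v = (\<lambda>U. mtrace N (?m (?Y U) P) - mtrace N (adj T) * mtrace N P / N)"
  define h2 where "h2 = (\<lambda>U. mtrace N (?m (orbit N (?m (adj T) T) U) Q) - mtrace N (?m (adj T) T) * mtrace N Q / N)"
  have i1: "integrable \<mu> (\<lambda>U. (cmod (h1 U))\<^sup>2)" "(\<integral>U. (cmod (h1 U))\<^sup>2 \<partial>\<mu>) \<le> 2 / N"
    unfolding h1_def using variance_linear[OF N op_bounded_mult[OF P Q, simplified], of "adj T"] by (auto simp: T1)
  have i2: "integrable \<mu> (\<lambda>U. (cmod (u U))\<^sup>2)" "(\<integral>U. (cmod (u U))\<^sup>2 \<partial>\<mu>) \<le> 2 / N"
    unfolding u_def using variance_linear[OF N Q, of T] by (auto simp: T1)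
  have i3: "integrable \<mu> (\<lambda>U. (cmod (v U))\<^sup>2)" "(\<integral>U. (cmod (v U))\<^sup>2 \<partial>\<mu>) \<le> 2 / N"
    unfolding v_def using variance_linear[OF N P, of "adj T"] by (auto simp: T1)
  have i4: "integrable \<mu> (\<lambda>U. (cmod (h2 U))\<^sup>2)" "(\<integral>U. (cmod (h2 U))\<^sup>2 \<partial>\<mu>) \<le> 2 * c\<^sup>2 / N"
  proof -
    show "integrable \<mu> (\<lambda>U. (cmod (h2 U))\<^sup>2)"
      unfolding h2_def using variance_linear[OF N Q] by auto
    have "(\<integral>U. (cmod (h2 U))\<^sup>2 \<partial>\<mu>) \<le> 2 * (frob N (?m (adj T) T))\<^sup>2 / N"
      unfolding h2_def using variance_linear[OF N Q] by auto
    also have "\<dots> \<le> 2 * c\<^sup>2 / N"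
      using frob_mult_left[OF Ta, of T] T1 by (intro divide_right_mono mult_left_mono power_mono) auto
    finally show "(\<integral>U. (cmod (h2 U))\<^sup>2 \<partial>\<mu>) \<le> 2 * c\<^sup>2 / N" .
  qed
  \<comment> \<open>The weights are squared coefficient bounds: sqrt N for the coefficients of
    \<open>h1\<close>, \<open>u\<close>, \<open>v\<close>, and \<open>N\<close> for that of
    \<open>h2\<close>.\<close>
  let ?s = "\<lambda>U. N * (cmod (h1 U))\<^sup>2 + N * (cmod (u U))\<^sup>2 + N * (cmod (v U))\<^sup>2 + (real N)\<^sup>2 * (cmod (h2 U))\<^sup>2"
  have bound: "real N / 2 * (cmod (?\<Delta> U))\<^sup>2 \<le> Re (\<Phi> U) + 4 * c\<^sup>2 + 2 / N * ?s U" if U: "is_unitary N U" for U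
  proof -
    define R where "R = (\<Sum>i<N. \<Sum>j<N. ?K U i j * ?G i j U)"
    have \<Phi>_eq: "\<Phi> U = (\<Sum>i<N. \<Sum>j<N. ?D i j i j U) * g U + R"
      by (simp only: \<Phi>_def R_def sum.distrib sum_distrib_right)
    define rest where "rest = ?\<tau> * h1 U - (u U * mtrace N (?m (?Y U) P) + ?\<tau> * mtrace N Q / N * v U)
        + mtrace N P * h2 U"
    have YX: "orbit N (?m (adj T) T) U = ?m (?Y U) (?X U)"
      by (simp add: orbit_mult[OF U])
    have t1: "mtrace N (?m Q (?m (?Y U) P)) = mtrace N (?m (?Y U) (?m P Q))"
      by (subst mtrace_mult_comm) (simp add: cmat_mult_assoc)
    have t2: "mtrace N (?m (?m (?X U) Q) (?Y U)) = mtrace N (?m (orbit N (?m (adj T) T) U) Q)"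
      unfolding YX by (subst mtrace_mult_comm) (simp add: cmat_mult_assoc)
    have t3: "mtrace N (?m (adj T) T) = 1"
      by (simp add: mtrace_adj_mult_self T1)
    have "(\<Sum>i<N. \<Sum>j<N. ?D i j i j U) = of_nat N * mtrace N (?K U) - mtrace N (?X U) * mtrace N (?m Q (?m (?Y U) P))
        + mtrace N (?m (?X U) Q) * mtrace N (?m (?Y U) P) - mtrace N (?m (?m (?X U) Q) (?Y U)) * mtrace N P"
      by (simp add: sum.distrib sum_subtractf mtrace_def sum_product)
    also have "\<dots> = of_nat N * ?\<Delta> U - rest"
      unfolding t1 t2 mtrace_orbit[OF U] rest_def h1_def u_def v_def h2_def t3 f_def f0_def mtrace_adj
        of_nat_mult mult_1
      using N by (intro quadratic_divergence_identity) simp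
    finally have "\<Phi> U = (of_nat N * ?\<Delta> U - rest) * g U + R" unfolding \<Phi>_eq by (rule arg_cong)
    also have "\<dots> = of_nat N * (?\<Delta> U * g U) - rest * g U + R" by (simp only: left_diff_distrib mult.assoc)
    also have "?\<Delta> U * g U = complex_of_real ((cmod (?\<Delta> U))\<^sup>2)"
      unfolding g by (rule complex_norm_square[symmetric])
    finally have eq: "real N * (cmod (?\<Delta> U))\<^sup>2 = Re (\<Phi> U) + Re (rest * g U) + Re (- R)" by simp
    have x: "frob N (?X U) \<le> 1" "frob N (?Y U) \<le> 1"
      using frob_orbit_le[OF U, of T] frob_orbit_le[OF U, of "adj T"] T1 by auto
    have ox: "op_bounded N (?X U) c" "op_bounded N (?Y U) c"
      using op_bounded_orbit[OF U] T Ta by auto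
    have half: "4 * s / real (2 * N) = 2 / real N * s" for s by simp
    have R: "cmod R \<le> 4 * c\<^sup>2"
    proof -
      \<comment> \<open>One orbit factor is measured in operator norm, giving \<open>c\<close>, the
        other in Frobenius norm, giving 1. The next three bounds distribute the norms in the same
        way.\<close>
      have fK: "frob N (?m (?m (?X U) Q') (?m (?Y U) P')) \<le> c" if "op_bounded N P' 1" "op_bounded N Q' 1" for P' Q'
        using frob_mult_left[OF op_bounded_mult[OF ox(1) that(2)], of "?m (?Y U) P'"]
          frob_mult_right[OF that(1), of "?Y U"] x mult_left_mono[of "frob N (?m (?Y U) P')" 1 c] c0 by simp
      have f2: "frob N (?m (?m (adj Q) (?m (?Y U) (adj P))) (?X U)) \<le> c"
        using frob_mult_left[OF op_bounded_mult[OF Qa op_bounded_mult[OF ox(2) Pa]], of "?X U"] x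
          mult_left_mono[of "frob N (?X U)" 1 c] c0 by simp
      have f3: "frob N (?m (?m (?Y U) (adj P)) (?m (?X U) (adj Q))) \<le> c"
        using frob_mult_left[OF op_bounded_mult[OF ox(2) Pa], of "?m (?X U) (adj Q)"]
          frob_mult_right[OF Qa, of "?X U"] x mult_left_mono[of "frob N (?m (?X U) (adj Q))" 1 c] c0 by simp
      have f4: "frob N (?m (adj P) (?m (?m (?X U) (adj Q)) (?Y U))) \<le> c"
        using frob_mult_left[OF Pa, of "?m (?m (?X U) (adj Q)) (?Y U)"]
          frob_mult_left[OF op_bounded_mult[OF ox(1) Qa], of "?Y U"] x
          mult_left_mono[of "frob N (?Y U)" 1 c] c0 by simp
      have Req: "R = (\<Sum>i<N. \<Sum>j<N. ?K U i j * ?m (?m (?X U) (adj Q)) (?m (?Y U) (adj P)) j i)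
        - (\<Sum>i<N. \<Sum>j<N. ?K U i j * ?m (?m (adj Q) (?m (?Y U) (adj P))) (?X U) j i)
        + (\<Sum>i<N. \<Sum>j<N. ?K U i j * ?m (?m (?Y U) (adj P)) (?m (?X U) (adj Q)) j i)
        - (\<Sum>i<N. \<Sum>j<N. ?K U i j * ?m (adj P) (?m (?m (?X U) (adj Q)) (?Y U)) j i)"
        by (simp only: R_def distrib_left right_diff_distrib sum_subtractf sum.distrib)
      have "cmod R \<le> c * c + c * c + c * c + c * c"
        unfolding Req
      proof (rule order_trans[OF norm_triangle_ineq4 add_mono[OF norm_triangle_mono[OF order_trans[OF norm_triangle_ineq4 add_mono]]]])
        show "cmod (\<Sum>i<N. \<Sum>j<N. ?K U i j * ?m (?m (?X U) (adj Q)) (?m (?Y U) (adj P)) j i) \<le> c * c"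
          by (rule order_trans[OF sum_mult_le_frob mult_mono]) (auto intro!: fK P Q Pa Qa c0)
        show "cmod (\<Sum>i<N. \<Sum>j<N. ?K U i j * ?m (?m (adj Q) (?m (?Y U) (adj P))) (?X U) j i) \<le> c * c"
          by (rule order_trans[OF sum_mult_le_frob mult_mono]) (auto intro!: fK P Q f2 c0)
        show "cmod (\<Sum>i<N. \<Sum>j<N. ?K U i j * ?m (?m (?Y U) (adj P)) (?m (?X U) (adj Q)) j i) \<le> c * c"
          by (rule order_trans[OF sum_mult_le_frob mult_mono]) (auto intro!: fK P Q f3 c0)
        show "cmod (\<Sum>i<N. \<Sum>j<N. ?K U i j * ?m (adj P) (?m (?m (?X U) (adj Q)) (?Y U)) j i) \<le> c * c"
          by (rule order_trans[OF sum_mult_le_frob mult_mono]) (auto intro!: fK P Q f4 c0)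
      qed
      then show ?thesis by (simp add: power2_eq_square)
    qed
    have rest: "(cmod rest)\<^sup>2 \<le> 4 * ?s U"
    proof -
      have \<tau>: "cmod ?\<tau> \<le> sqrt N" using mtrace_le_frob[of N T] T1 by simp
      have w: "cmod (mtrace N (?m (?Y U) P)) \<le> sqrt N"
        using mtrace_mult_le_frob[of N "?Y U" P] mult_mono[OF x(2) frob_le_op_bounded[OF P]] by simp
      have q: "cmod (mtrace N Q) \<le> N" "cmod (mtrace N P) \<le> N"
        using mtrace_le_op_bounded[OF Q] mtrace_le_op_bounded[OF P] by auto
      have u0: "cmod (?\<tau> * mtrace N Q / N) \<le> sqrt N"
        using mult_mono[OF \<tau> q(1)] N by (simp add: norm_mult norm_divide pos_divide_le_eq)
      let ?a = "cmod (?\<tau> * h1 U)" and ?b = "cmod (u U * mtrace N (?m (?Y U) P))"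
        and ?c = "cmod (?\<tau> * mtrace N Q / N * v U)" and ?d = "cmod (mtrace N P * h2 U)"
      have "cmod rest \<le> ?a + (?b + ?c) + ?d"
        unfolding rest_def
        by (intro norm_triangle_mono order_trans[OF norm_triangle_ineq4 add_mono] norm_triangle_ineq order_refl)
      then have "(cmod rest)\<^sup>2 \<le> (?a + (?b + ?c) + ?d)\<^sup>2" by (intro power_mono) auto
      also have "\<dots> \<le> 4 * (?a\<^sup>2 + ?b\<^sup>2 + ?c\<^sup>2 + ?d\<^sup>2)"
        by (rule sum4_square_le)
      also have "\<dots> \<le> 4 * ?s U"
      proof (intro mult_left_mono add_mono)
        have sq: "(cmod z)\<^sup>2 \<le> real N" if "cmod z \<le> sqrt N" for z
          using power_mono[OF that, of 2] by simp
        show "?a\<^sup>2 \<le> N * (cmod (h1 U))\<^sup>2" using sq[OF \<tau>] by (simp add: norm_mult power_mult_distrib mult_right_mono)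
        show "?b\<^sup>2 \<le> N * (cmod (u U))\<^sup>2" using mult_right_mono[OF sq[OF w], of "(cmod (u U))\<^sup>2"] by (simp add: norm_mult power_mult_distrib mult.commute)
        show "?c\<^sup>2 \<le> N * (cmod (v U))\<^sup>2"
          unfolding norm_mult[of _ "v U"] power_mult_distrib by (intro mult_right_mono sq[OF u0]) auto
        show "?d\<^sup>2 \<le> (real N)\<^sup>2 * (cmod (h2 U))\<^sup>2"
          unfolding norm_mult power_mult_distrib using q by (intro mult_right_mono power_mono) auto
      qed simp
      finally show ?thesis .
    qed
    have "Re (rest * g U) \<le> cmod rest * cmod (?\<Delta> U)"
      using complex_Re_le_cmod[of "rest * g U"] by (simp only: norm_mult g complex_mod_cnj)
    \<comment> \<open>Young's inequality weighted by \<open>N\<close>, so that the second summand is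
      exactly half of the leading term and moves to the left side.\<close>
    also have "\<dots> \<le> (cmod rest)\<^sup>2 / (2 * N) + N / 2 * (cmod (?\<Delta> U))\<^sup>2"
    proof -
      have "0 \<le> (cmod rest - N * cmod (?\<Delta> U))\<^sup>2 / (2 * N)" by simp
      also have "\<dots> = (cmod rest)\<^sup>2 / (2 * N) + N / 2 * (cmod (?\<Delta> U))\<^sup>2 - cmod rest * cmod (?\<Delta> U)"
        using N by (simp add: power2_eq_square field_simps)
      finally show ?thesis by simp
    qed
    also have "(cmod rest)\<^sup>2 / (2 * N) \<le> 4 * ?s U / (2 * N)"
      using rest by (intro divide_right_mono) auto
    finally have "Re (rest * g U) \<le> 4 * ?s U / (2 * N) + N / 2 * (cmod (?\<Delta> U))\<^sup>2" by simp
    moreover have "4 * ?s U / (2 * N) = 2 / N * ?s U" by (rule half)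
    moreover have "Re (- R) \<le> 4 * c\<^sup>2" using complex_Re_le_cmod[of "- R"] R by simp
    ultimately show ?thesis using eq by linarith
  qed
  have "(\<integral>U. real N / 2 * (cmod (?\<Delta> U))\<^sup>2 \<partial>\<mu>) \<le> (\<integral>U. Re (\<Phi> U) + 4 * c\<^sup>2 + 2 / N * ?s U \<partial>\<mu>)"
    using AE_unitary bound int \<Phi>(1) i1 i2 i3 i4 by (intro integral_mono_AE) auto
  also have "\<dots> = 4 * c\<^sup>2 + 2 / N * (N * (\<integral>U. (cmod (h1 U))\<^sup>2 \<partial>\<mu>) + N * (\<integral>U. (cmod (u U))\<^sup>2 \<partial>\<mu>)
       + N * (\<integral>U. (cmod (v U))\<^sup>2 \<partial>\<mu>) + (real N)\<^sup>2 * (\<integral>U. (cmod (h2 U))\<^sup>2 \<partial>\<mu>))"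
    using \<Phi> i1(1) i2(1) i3(1) i4(1) by (simp add: prob_space)
  also have "\<dots> \<le> 4 * c\<^sup>2 + 2 / N * (N * (2 / N) + N * (2 / N) + N * (2 / N) + (real N)\<^sup>2 * (2 * c\<^sup>2 / N))"
    by (intro add_mono mult_left_mono i1 i2 i3 i4) auto
  also have "\<dots> = real N / 2 * (24 / (real N)\<^sup>2 + 16 * c\<^sup>2 / N)"
    using N by (simp add: field_simps power2_eq_square)
  finally have "real N / 2 * (\<integral>U. (cmod (?\<Delta> U))\<^sup>2 \<partial>\<mu>) \<le> real N / 2 * (24 / (real N)\<^sup>2 + 16 * c\<^sup>2 / N)"
    by simp
  then show "(\<integral>U. (cmod (?\<Delta> U))\<^sup>2 \<partial>\<mu>) \<le> 24 / (real N)\<^sup>2 + 16 * c\<^sup>2 / N"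
    using N by (subst (asm) mult_le_cancel_left_pos) auto
qed

end

section \<open>Block structure of the channel output\<close>

text \<open>With V the first d columns of U, V A V* equals U (pad A) U*: zero rows and columns
  replace the truncation, and the full unitary group acts.\<close>

definition pad :: "nat \<Rightarrow> cmat \<Rightarrow> cmat" where
  "pad d A = (\<lambda>i j. if i < d \<and> j < d then A i j else 0)"

text \<open>\<open>block_unit n c c'\<close> is \<open>E\<^sub>c\<^sub>c\<^sub>' \<otimes> I\<^sub>n\<close> in the basis \<open>|a>|b> \<mapsto> a * n + b\<close>.\<close>

definition block_unit :: "nat \<Rightarrow> nat \<Rightarrow> nat \<Rightarrow> cmat" where
  "block_unit n c c' = (\<lambda>r s. if r div n = c \<and> s div n = c' \<and> r mod n = s mod n then 1 else 0)"

text \<open>Sums against a \<open>block_unit\<close> are brought to this form: the indices with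
  quotient \<open>c\<close> are the image of b \<mapsto> c n + b, and c < k keeps them in
  range.\<close>

lemma sum_block:
  fixes g :: "nat \<Rightarrow> 'a::comm_monoid_add"
  assumes "0 < n" "c < k"
  shows "(\<Sum>r<n * k. if r div n = c then g r else 0) = (\<Sum>b<n. g (c * n + b))"
proof -
  have im: "{r \<in> {..<n * k}. r div n = c} = (\<lambda>b. c * n + b) ` {..<n}"
  proof (rule Set.set_eqI, rule iffI)
    fix r assume "r \<in> {r \<in> {..<n * k}. r div n = c}"
    then show "r \<in> (\<lambda>b. c * n + b) ` {..<n}"
      using assms by (intro image_eqI[of _ _ "r mod n"]) auto
  next
    fix r assume "r \<in> (\<lambda>b. c * n + b) ` {..<n}"
    then obtain b where b: "r = c * n + b" "b < n" by auto
    have "c * n + b < Suc c * n" using b by simp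
    also have "\<dots> \<le> k * n" using assms by (intro mult_right_mono) auto
    finally show "r \<in> {r \<in> {..<n * k}. r div n = c}" using b assms by (simp add: mult.commute)
  qed
  have "(\<Sum>r<n * k. if r div n = c then g r else 0) = sum g {r \<in> {..<n * k}. r div n = c}"
    by (rule sum.inter_filter[symmetric]) simp
  also have "\<dots> = (\<Sum>b<n. g (c * n + b))"
    unfolding im by (subst sum.reindex) (auto simp: inj_on_def)
  finally show ?thesis .
qed

lemma cmat_mult_block_unit:
  assumes "0 < n" "c < k"
  shows "cmat_mult (n * k) X (block_unit n c c') r p = (if p div n = c' then X r (c * n + p mod n) else 0)"
proof -
  have "cmat_mult (n * k) X (block_unit n c c') r p =
      (\<Sum>s<n * k. if s div n = c then (if p div n = c' \<and> s mod n = p mod n then X r s else 0) else 0)"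
    unfolding cmat_mult_def block_unit_def by (intro sum.cong refl) auto
  also have "\<dots> = (\<Sum>b<n. if b = p mod n then (if p div n = c' then X r (c * n + b) else 0) else 0)"
    unfolding sum_block[OF assms] using assms by (intro sum.cong refl) auto
  also have "\<dots> = (if p div n = c' then X r (c * n + p mod n) else 0)"
    using assms by simp
  finally show ?thesis .
qed

text \<open>A partial isometry: block c' is carried isometrically onto block c and all other blocks
  are sent to 0.\<close>

lemma op_bounded_block_unit:
  assumes "0 < n" "c < k" "c' < k"
  shows "op_bounded (n * k) (block_unit n c c') 1"
  unfolding op_bounded_def
proof (intro conjI allI)
  fix x
  have e: "(\<Sum>j<n * k. block_unit n c c' i j * x j) = (if i div n = c then x (c' * n + i mod n) else 0)" for i
  proof -
    have "(\<Sum>j<n * k. block_unit n c c' i j * x j) =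
      (\<Sum>s<n * k. if s div n = c' then (if i div n = c \<and> s mod n = i mod n then x s else 0) else 0)"
      unfolding block_unit_def by (intro sum.cong refl) auto
    also have "\<dots> = (\<Sum>b<n. if b = i mod n then (if i div n = c then x (c' * n + b) else 0) else 0)"
      unfolding sum_block[OF assms(1,3)] using assms by (intro sum.cong refl) auto
    finally show ?thesis using assms by simp
  qed
  have "(\<Sum>i<n * k. (cmod (\<Sum>j<n * k. block_unit n c c' i j * x j))\<^sup>2)
      = (\<Sum>i<n * k. if i div n = c then (cmod (x (c' * n + i mod n)))\<^sup>2 else 0)"
    unfolding e by (intro sum.cong refl) auto
  also have "\<dots> = (\<Sum>b<n. (cmod (x (c' * n + b)))\<^sup>2)"
    unfolding sum_block[OF assms(1,2)] by (intro sum.cong refl) auto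
  also have "\<dots> = (\<Sum>i<n * k. if i div n = c' then (cmod (x i))\<^sup>2 else 0)"
    unfolding sum_block[OF assms(1,3)] ..
  also have "\<dots> \<le> (\<Sum>i<n * k. (cmod (x i))\<^sup>2)"
    by (intro sum_mono) auto
  finally show "L2_set (\<lambda>i. cmod (\<Sum>j<n * k. block_unit n c c' i j * x j)) {..<n * k}
      \<le> 1 * L2_set (\<lambda>j. cmod (x j)) {..<n * k}"
    by (simp add: L2_set_def)
qed simp

lemma mtrace_block_unit:
  assumes "0 < n" "c < k"
  shows "mtrace (n * k) (block_unit n c c') = (if c = c' then of_nat n else 0)"
proof -
  have "mtrace (n * k) (block_unit n c c') = (\<Sum>i<n * k. if i div n = c then (if c = c' then 1 else 0) else 0)"
    unfolding mtrace_def block_unit_def by (intro sum.cong refl) auto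
  then show ?thesis unfolding sum_block[OF assms] by simp
qed

lemma mtrace_block_unit_mult:
  assumes "0 < n" "c < k" "c' < k" "a < k" "a' < k"
  shows "mtrace (n * k) (cmat_mult (n * k) (block_unit n a' a) (block_unit n c c'))
     = (if a = c \<and> a' = c' then of_nat n else 0)"
proof -
  have "mtrace (n * k) (cmat_mult (n * k) (block_unit n a' a) (block_unit n c c'))
     = (\<Sum>i<n * k. if i div n = c' then block_unit n a' a i (c * n + i mod n) else 0)"
    unfolding mtrace_def cmat_mult_block_unit[OF assms(1,2)] ..
  also have "\<dots> = (\<Sum>b<n. if a = c \<and> a' = c' then 1 else 0)"
    unfolding sum_block[OF assms(1,3)] block_unit_def using assms by (intro sum.cong refl) auto
  finally show ?thesis by simp
qed

text \<open>Each \<open>block_unit\<close> fixes the block indices and aligns the inner ones; the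
  two surviving sums are the partial traces over the two copies of C^n.\<close>

lemma mtrace_quadratic_block_unit:
  assumes "0 < n" "c < k" "c' < k" "a < k" "a' < k"
  shows "mtrace (n * k) (cmat_mult (n * k) (cmat_mult (n * k) X (block_unit n c c')) (cmat_mult (n * k) Y (block_unit n a' a)))
     = (\<Sum>b<n. \<Sum>b'<n. X (a * n + b) (c * n + b') * Y (c' * n + b') (a' * n + b))"
proof -
  have "mtrace (n * k) (cmat_mult (n * k) (cmat_mult (n * k) X (block_unit n c c')) (cmat_mult (n * k) Y (block_unit n a' a)))
    = (\<Sum>r<n * k. if r div n = a then (\<Sum>p<n * k. if p div n = c' then X r (c * n + p mod n) * Y p (a' * n + r mod n) else 0) else 0)"
    unfolding mtrace_def cmat_mult_def[of "n * k" "cmat_mult (n * k) X (block_unit n c c')"]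
      cmat_mult_block_unit[OF assms(1,2)] cmat_mult_block_unit[OF assms(1,5)]
    by (auto intro!: sum.cong)
  then show ?thesis
    unfolding sum_block[OF assms(1,4)] sum_block[OF assms(1,3)] by simp
qed

section \<open>Zero padding and the operator norm\<close>

lemma sum_pad:
  fixes f :: "nat \<Rightarrow> nat \<Rightarrow> 'a::comm_monoid_add"
  assumes "d \<le> N" shows "(\<Sum>i<N. \<Sum>j<N. if i < d \<and> j < d then f i j else 0) = (\<Sum>i<d. \<Sum>j<d. f i j)"
proof -
  have "(\<Sum>j<N. if i < d \<and> j < d then f i j else 0) = (if i < d then (\<Sum>j<d. f i j) else 0)" for i
    using assms by (auto intro!: sum.mono_neutral_cong_right split: if_splits)
  then have "(\<Sum>i<N. \<Sum>j<N. if i < d \<and> j < d then f i j else 0) = (\<Sum>i<N. if i < d then (\<Sum>j<d. f i j) else 0)"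
    by simp
  also have "\<dots> = (\<Sum>i<d. \<Sum>j<d. f i j)"
    using assms by (intro sum.mono_neutral_cong_right) auto
  finally show ?thesis .
qed

lemma orbit_pad:
  assumes "d \<le> N"
  shows "orbit N (pad d A) U a b = (\<Sum>i<d. \<Sum>j<d. U (a,i) * A i j * cnj (U (b,j)))"
  unfolding orbit_expand pad_def sum_pad[OF assms, symmetric] by (intro sum.cong refl) auto

lemma frob_pad_square: "d \<le> N \<Longrightarrow> (frob N (pad d A))\<^sup>2 = (\<Sum>i<d. \<Sum>j<d. (cmod (A i j))\<^sup>2)"
  unfolding frob_square pad_def by (subst sum_pad[symmetric, of d N]) (auto intro!: sum.cong)

lemma mtrace_pad: "d \<le> N \<Longrightarrow> mtrace N (pad d A) = mtrace d A"
  unfolding mtrace_def pad_def by (auto intro!: sum.mono_neutral_cong_right split: if_splits)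

lemma op_bounded_pad:
  assumes "d \<le> N" "op_bounded d A c" shows "op_bounded N (pad d A) c"
  unfolding op_bounded_def
proof (intro conjI allI)
  show c: "0 \<le> c" using assms(2) by (rule op_bounded_nonneg)
  fix x
  have "(\<Sum>j<N. pad d A i j * x j) = (if i < d then (\<Sum>j<d. A i j * x j) else 0)" for i
    using assms(1) by (auto simp: pad_def intro!: sum.mono_neutral_cong_right split: if_splits)
  then have "(\<Sum>i<N. (cmod (\<Sum>j<N. pad d A i j * x j))\<^sup>2) = (\<Sum>i<d. (cmod (\<Sum>j<d. A i j * x j))\<^sup>2)"
    using assms(1) by (auto intro!: sum.mono_neutral_cong_right split: if_splits)
  then have "L2_set (\<lambda>i. cmod (\<Sum>j<N. pad d A i j * x j)) {..<N} = L2_set (\<lambda>i. cmod (\<Sum>j<d. A i j * x j)) {..<d}"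
    by (simp add: L2_set_def)
  also have "\<dots> \<le> c * L2_set (\<lambda>j. cmod (x j)) {..<d}"
    by (rule op_boundedD[OF assms(2)])
  also have "\<dots> \<le> c * L2_set (\<lambda>j. cmod (x j)) {..<N}"
    unfolding L2_set_def using assms(1) c by (intro mult_left_mono real_sqrt_le_mono sum_mono2) auto
  finally show "L2_set (\<lambda>i. cmod (\<Sum>j<N. pad d A i j * x j)) {..<N} \<le> c * L2_set (\<lambda>j. cmod (x j)) {..<N}" .
qed

text \<open>Shows that the supremum defining \<open>op_norm\<close> is taken over a set bounded
  above.\<close>

lemma op_bounded_frob: "op_bounded d A (frob d A)"
  unfolding op_bounded_def
proof (intro conjI allI)
  fix x
  let ?n = "L2_set (\<lambda>j. cmod (x j)) {..<d}"
  have "(cmod (\<Sum>j<d. A i j * x j))\<^sup>2 \<le> (\<Sum>j<d. (cmod (A i j))\<^sup>2) * ?n\<^sup>2" for i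
  proof -
    have "cmod (\<Sum>j<d. A i j * x j) \<le> (\<Sum>j<d. \<bar>cmod (A i j)\<bar> * \<bar>cmod (x j)\<bar>)"
      by (rule order_trans[OF norm_sum]) (simp add: norm_mult)
    also have "\<dots> \<le> L2_set (\<lambda>j. cmod (A i j)) {..<d} * ?n" by (rule L2_set_mult_ineq)
    finally have "(cmod (\<Sum>j<d. A i j * x j))\<^sup>2 \<le> (L2_set (\<lambda>j. cmod (A i j)) {..<d} * ?n)\<^sup>2"
      by (intro power_mono) auto
    then show ?thesis by (simp add: power_mult_distrib L2_set_square)
  qed
  then have "(\<Sum>i<d. (cmod (\<Sum>j<d. A i j * x j))\<^sup>2) \<le> (\<Sum>i<d. (\<Sum>j<d. (cmod (A i j))\<^sup>2) * ?n\<^sup>2)"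
    by (intro sum_mono)
  also have "\<dots> = (frob d A * ?n)\<^sup>2"
    by (simp add: frob_square power_mult_distrib sum_distrib_right)
  finally show "L2_set (\<lambda>i. cmod (\<Sum>j<d. A i j * x j)) {..<d} \<le> frob d A * ?n"
    unfolding L2_set_def[of "\<lambda>i. cmod (\<Sum>j<d. A i j * x j)"] by (intro real_le_lsqrt) auto
qed simp

lemma op_bounded_op_norm: "op_bounded d A (op_norm d A)"
  unfolding op_bounded_def
proof (intro conjI allI)
  let ?n = "\<lambda>x. L2_set (\<lambda>j. cmod (x j)) {..<d}"
  let ?A = "\<lambda>x i. \<Sum>j<d. A i j * x j"
  let ?S = "{sqrt (\<Sum>i<d. (cmod (?A x i))\<^sup>2) | x. (\<Sum>j<d. (cmod (x j))\<^sup>2) \<le> 1}"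
  have bdd: "bdd_above ?S"
  proof (rule bdd_aboveI[of _ "frob d A"])
    fix y assume "y \<in> ?S"
    then obtain x where y: "y = ?n (?A x)" and x: "?n x \<le> 1" by (auto simp: L2_set_def)
    show "y \<le> frob d A"
      using op_boundedD[OF op_bounded_frob[of d A], of x] mult_left_mono[OF x frob_nonneg[of d A]] y by simp
  qed
  have le: "?n (?A x) \<le> op_norm d A" if "?n x \<le> 1" for x
    unfolding op_norm_def
  proof (rule cSup_upper[OF _ bdd])
    show "?n (?A x) \<in> ?S" using that by (auto simp: L2_set_def)
  qed
  show nn: "0 \<le> op_norm d A"
    using le[of "\<lambda>_. 0"] by (simp add: L2_set_def)
  fix x
  show "?n (?A x) \<le> op_norm d A * ?n x"
  proof (cases "?n x = 0")
    \<comment> \<open>A vector of norm zero cannot be rescaled to the unit sphere; the Frobenius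
      bound already gives 0 on the left.\<close>
    case True
    then show ?thesis using op_boundedD[OF op_bounded_frob[of d A], of x] by simp
  next
    case False
    then have pos: "0 < ?n x" using L2_set_nonneg[of "\<lambda>j. cmod (x j)" "{..<d}"] by linarith
    let ?s = "1 / ?n x"
    let ?y = "\<lambda>j. complex_of_real ?s * x j"
    have sc: "L2_set (\<lambda>j. cmod (complex_of_real ?s * z j)) {..<d} = ?s * ?n z" for z
      using pos by (subst L2_set_right_distrib) (auto simp: norm_mult norm_divide)
    have Ay: "?A ?y i = complex_of_real ?s * ?A x i" for i
      by (simp add: sum_distrib_left sum_divide_distrib mult_ac)
    have "?n (?A ?y) = ?s * ?n (?A x)" unfolding Ay by (rule sc)
    moreover have "?n ?y \<le> 1" using sc[of x] pos by simp
    ultimately have "?s * ?n (?A x) \<le> op_norm d A" using le[of ?y] by simp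
    then show ?thesis using pos by (simp add: pos_divide_le_eq)
  qed
qed

section \<open>Entries of the channel output as traces\<close>

lemma sum_swap_out4:
  "(\<Sum>i\<in>I. \<Sum>j\<in>J. \<Sum>k\<in>K. \<Sum>l\<in>L. \<Sum>b\<in>B. f i j k l b) = (\<Sum>b\<in>B. \<Sum>i\<in>I. \<Sum>j\<in>J. \<Sum>k\<in>K. \<Sum>l\<in>L. f i j k l b)"
  by (simp only: sum.swap[of _ _ B])

text \<open>Applying V and its conjugate to the two legs of the input vector gives the vectorisation
  of X = V A V*. Hence the output is the partial trace, over both copies of C^n, of the projection
  onto that vector.\<close>

lemma Z_mat_expand:
  fixes U :: "nat \<times> nat \<Rightarrow> complex" and A :: cmat and d :: nat
  defines "X \<equiv> \<lambda>a b. \<Sum>i<d. \<Sum>j<d. U (a,i) * A i j * cnj (U (b,j))"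
  shows "Z_mat k n d U A r r' = (\<Sum>b<n. \<Sum>b'<n. X (r div k * n + b) (r mod k * n + b')
      * cnj (X (r' div k * n + b) (r' mod k * n + b')))"
proof -
  have cb: "conjugate_by d V (mat_unit i i') x y = V x i * cnj (V y i')" if "i < d" "i' < d" for V i i' x y
  proof -
    have "conjugate_by d V (mat_unit i i') x y
       = (\<Sum>p<d. \<Sum>q<d. if q = i' then (if p = i then V x i * cnj (V y i') else 0) else 0)"
      unfolding conjugate_by_def mat_unit_def by (intro sum.cong refl) auto
    then show ?thesis using that by simp
  qed
  let ?a = "r div k" and ?a' = "r' div k" and ?c = "r mod k" and ?c' = "r' mod k"
  have "Z_mat k n d U A r r' = (\<Sum>i<d. \<Sum>j<d. \<Sum>i'<d. \<Sum>j'<d. A i j * cnj (A i' j')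
      * (\<Sum>b<n. U (?a * n + b, i) * cnj (U (?a' * n + b, i')))
      * (\<Sum>b'<n. cnj (U (?c * n + b', j)) * U (?c' * n + b', j')))"
    unfolding Z_mat_def tensor_map_def comp_channel_def ptrace2_def proj_def vec_of_mat_def
    by (intro sum.cong refl) (simp add: cb isom_def conj_isom_def)
  also have "\<dots> = (\<Sum>i<d. \<Sum>j<d. \<Sum>i'<d. \<Sum>j'<d. \<Sum>b<n. \<Sum>b'<n.
      (U (?a * n + b, i) * A i j * cnj (U (?c * n + b', j))) *
      cnj (U (?a' * n + b, i') * A i' j' * cnj (U (?c' * n + b', j'))))"
    by (intro sum.cong refl) (simp add: sum_product sum_distrib_left mult_ac)
  also have "\<dots> = (\<Sum>b<n. \<Sum>b'<n. \<Sum>i<d. \<Sum>j<d. \<Sum>i'<d. \<Sum>j'<d.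
      (U (?a * n + b, i) * A i j * cnj (U (?c * n + b', j))) *
      cnj (U (?a' * n + b, i') * A i' j' * cnj (U (?c' * n + b', j'))))"
    by (subst sum_swap_out4, rule sum.cong[OF refl], rule sum_swap_out4)
  also have "\<dots> = (\<Sum>b<n. \<Sum>b'<n. X (?a * n + b) (?c * n + b') * cnj (X (?a' * n + b) (?c' * n + b')))"
    unfolding X_def cnj_sum sum_distrib_right unfolding sum_distrib_left ..
  finally show ?thesis .
qed

text \<open>The conjugated factor is an entry of X* with its indices exchanged, which is why
  \<open>r'\<close> precedes \<open>r\<close> in the second \<open>block_unit\<close>.\<close>

lemma Z_mat_eq_mtrace:
  assumes "0 < n" "d \<le> n * k" "r < k\<^sup>2" "r' < k\<^sup>2"
  shows "Z_mat k n d U A r r' = mtrace (n * k)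
     (cmat_mult (n * k) (cmat_mult (n * k) (orbit (n * k) (pad d A) U) (block_unit n (r mod k) (r' mod k)))
       (cmat_mult (n * k) (orbit (n * k) (adj (pad d A)) U) (block_unit n (r' div k) (r div k))))"
proof -
  have k: "0 < k" using assms(3) by (cases k) auto
  have "r div k < k" "r' div k < k" "r mod k < k" "r' mod k < k"
    using assms k by (auto simp: less_mult_imp_div_less power2_eq_square)
  then show ?thesis
    unfolding Z_mat_expand orbit_pad[OF assms(2), symmetric] adj_orbit[symmetric]
    using assms(1) by (subst mtrace_quadratic_block_unit) (auto simp: adj_def)
qed

text \<open>By Tonelli the series of squared moduli has finite integral, so it converges almost
  surely and its terms tend to 0. The joint law of the \<open>X n\<close> does not enter.\<close>

lemma AE_tendsto_zero_of_summable_moments: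
  fixes X :: "nat \<Rightarrow> 'a \<Rightarrow> complex"
  assumes int: "\<And>n. integrable M (\<lambda>\<omega>. (cmod (X n \<omega>))\<^sup>2)"
    and le: "\<And>n. (\<integral>\<omega>. (cmod (X n \<omega>))\<^sup>2 \<partial>M) \<le> b n" and b: "summable b"
  shows "AE \<omega> in M. (\<lambda>n. X n \<omega>) \<longlonglongrightarrow> 0"
proof -
  let ?f = "\<lambda>n \<omega>. ennreal ((cmod (X n \<omega>))\<^sup>2)"
  have meas: "?f n \<in> borel_measurable M" for n
    using borel_measurable_integrable[OF int] by measurable
  have "0 \<le> b n" for n
    by (rule order_trans[OF Bochner_Integration.integral_nonneg le]) simp
  have "(\<integral>\<^sup>+\<omega>. (\<Sum>n. ?f n \<omega>) \<partial>M) = (\<Sum>n. \<integral>\<^sup>+\<omega>. ?f n \<omega> \<partial>M)"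
    by (rule nn_integral_suminf) (rule meas)
  also have "\<dots> \<le> (\<Sum>n. ennreal (b n))"
    using int le by (intro suminf_le) (auto simp: nn_integral_eq_integral ennreal_leI)
  also have "\<dots> = ennreal (suminf b)"
    using b \<open>\<And>n. 0 \<le> b n\<close> by (simp add: suminf_ennreal2)
  finally have "(\<integral>\<^sup>+\<omega>. (\<Sum>n. ?f n \<omega>) \<partial>M) \<noteq> \<infinity>" by (auto simp: top_unique)
  then have "AE \<omega> in M. (\<Sum>n. ?f n \<omega>) \<noteq> \<infinity>"
    using meas by (intro nn_integral_PInf_AE) auto
  then show ?thesis
  proof eventually_elim
    case (elim \<omega>)
    then have "summable (\<lambda>n. (cmod (X n \<omega>))\<^sup>2)"
      by (intro summable_suminf_not_top) auto
    then have "(\<lambda>n. sqrt ((cmod (X n \<omega>))\<^sup>2)) \<longlonglongrightarrow> sqrt 0"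
      by (intro tendsto_real_sqrt summable_LIMSEQ_zero)
    then show ?case by (simp add: tendsto_norm_zero_iff)
  qed
qed

section \<open>Eigenvalues\<close>

lemma trace_mat_mult_comm:
  fixes X Y :: "complex mat"
  assumes "X \<in> carrier_mat n n" "Y \<in> carrier_mat n n"
  shows "(\<Sum>i<n. (X * Y) $$ (i,i)) = (\<Sum>i<n. (Y * X) $$ (i,i))"
proof -
  have "(\<Sum>i<n. (X * Y) $$ (i,i)) = (\<Sum>i<n. \<Sum>j<n. X $$ (i,j) * Y $$ (j,i))"
    using assms by (auto simp: scalar_prod_def atLeast0LessThan intro!: sum.cong)
  also have "\<dots> = (\<Sum>j<n. \<Sum>i<n. X $$ (i,j) * Y $$ (j,i))" by (rule sum.swap)
  also have "\<dots> = (\<Sum>i<n. (Y * X) $$ (i,i))"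
    using assms by (auto simp: scalar_prod_def atLeast0LessThan mult.commute intro!: sum.cong)
  finally show ?thesis .
qed

lemma to_mat_carrier [simp]: "to_mat K Z \<in> carrier_mat K K"
  by (simp add: to_mat_def)

text \<open>The characteristic polynomial splits over the complex numbers, and Schur
  triangularisation puts its roots, with multiplicity, on the diagonal of a similar matrix;
  similarity preserves the trace.\<close>

lemma eigenvalues_mset_size_sum:
  "size (eigenvalues_mset K Z) = K" "sum_mset (eigenvalues_mset K Z) = mtrace K Z"
proof -
  obtain es where es: "char_poly (to_mat K Z) = (\<Prod>e\<leftarrow>es. [:- e, 1:])" and len: "length es = K"
    using char_poly_factorized[OF to_mat_carrier] by blast
  have "proots (\<Prod>e\<leftarrow>es. [:- e, 1:]) = mset es"
  proof (induction es)
    case (Cons e es)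
    have "(\<Prod>e\<leftarrow>es. [:- e, 1:]) \<noteq> 0" by (auto simp: prod_list_zero_iff)
    then show ?case using Cons by (simp add: proots_mult del: mult_pCons_left)
  qed simp
  then have ms: "eigenvalues_mset K Z = mset es" by (simp add: eigenvalues_mset_def es)
  show "size (eigenvalues_mset K Z) = K" by (simp add: ms len)
  obtain B P Q where BPQ: "schur_decomposition (to_mat K Z) es = (B,P,Q)"
    by (cases "schur_decomposition (to_mat K Z) es") auto
  from schur_decomposition[OF to_mat_carrier es BPQ]
  have sim: "similar_mat_wit (to_mat K Z) B P Q" and diag: "diag_mat B = es" by auto
  from similar_mat_witD2[OF to_mat_carrier sim]
  have c: "Q * P = 1\<^sub>m K" "to_mat K Z = P * B * Q" "B \<in> carrier_mat K K" "P \<in> carrier_mat K K" "Q \<in> carrier_mat K K"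
    by auto
  have "mtrace K Z = (\<Sum>i<K. to_mat K Z $$ (i,i))" by (simp add: mtrace_def to_mat_def)
  also have "\<dots> = (\<Sum>i<K. (P * (B * Q)) $$ (i,i))" using c by simp
  also have "\<dots> = (\<Sum>i<K. (B * Q * P) $$ (i,i))" using c by (intro trace_mat_mult_comm) auto
  also have "B * Q * P = B" using c by simp
  also have "(\<Sum>i<K. B $$ (i,i)) = sum_list (diag_mat B)"
    using c by (simp add: diag_mat_def sum_list_distinct_conv_sum_set atLeast0LessThan)
  finally show "sum_mset (eigenvalues_mset K Z) = mtrace K Z"
    by (simp add: ms diag sum_mset_sum_list)
qed

text \<open>An eigenvector of Z for x is one of (Z - a)(Z - b) for (x - a)(x - b); comparing at its
  coordinate of largest modulus gives the bound. When that product tends to 0, every eigenvalue is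
  near a or b. Normality of Z is not involved.\<close>

lemma eigenvalue_quadratic_bound:
  assumes "x \<in># eigenvalues_mset K Z"
  shows "cmod (x - a) * cmod (x - b) \<le>
    (\<Sum>i<K. \<Sum>j<K. cmod (\<Sum>l<K. (Z i l - a * cmat_id i l) * (Z l j - b * cmat_id l j)))"
proof -
  have "char_poly (to_mat K Z) \<noteq> 0"
    using degree_monic_char_poly[OF to_mat_carrier, of K Z] by auto
  with assms have "poly (char_poly (to_mat K Z)) x = 0"
    by (simp add: eigenvalues_mset_def)
  then obtain w where w: "eigenvector (to_mat K Z) w x"
    unfolding eigenvalue_root_char_poly[OF to_mat_carrier, symmetric] eigenvalue_def by blast
  define v where "v = (\<lambda>i. w $ i)"
  have dw: "w \<in> carrier_vec K" "w \<noteq> 0\<^sub>v K" "to_mat K Z *\<^sub>v w = x \<cdot>\<^sub>v w"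
    using w by (auto simp: eigenvector_def to_mat_def)
  have Zv: "(\<Sum>j<K. Z i j * v j) = x * v i" if "i < K" for i
  proof -
    have "(to_mat K Z *\<^sub>v w) $ i = (\<Sum>j<K. Z i j * v j)"
      using that dw(1) by (auto simp: to_mat_def scalar_prod_def v_def atLeast0LessThan intro!: sum.cong)
    then show ?thesis using that dw by (simp add: v_def)
  qed
  define M where "M = (\<lambda>i j. \<Sum>l<K. (Z i l - a * cmat_id i l) * (Z l j - b * cmat_id l j))"
  have shift: "(\<Sum>j<K. (Z i j - b * cmat_id i j) * v j) = (x - b) * v i" if "i < K" for i b
  proof -
    have "(\<Sum>j<K. (Z i j - b * cmat_id i j) * v j) = (\<Sum>j<K. Z i j * v j) - (\<Sum>j<K. if j = i then b * v i else 0)"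
      unfolding sum_subtractf[symmetric] by (intro sum.cong refl) (auto simp: cmat_id_def algebra_simps)
    then show ?thesis using that Zv[OF that] by (simp add: algebra_simps)
  qed
  have Mv: "(\<Sum>j<K. M i j * v j) = (x - a) * (x - b) * v i" if "i < K" for i
  proof -
    have "(\<Sum>j<K. M i j * v j) = (\<Sum>l<K. (Z i l - a * cmat_id i l) * (\<Sum>j<K. (Z l j - b * cmat_id l j) * v j))"
      unfolding M_def sum_distrib_right sum_distrib_left by (subst sum.swap) (simp add: mult.assoc)
    also have "\<dots> = (\<Sum>l<K. (Z i l - a * cmat_id i l) * ((x - b) * v l))"
      by (intro sum.cong refl) (simp add: shift)
    also have "\<dots> = (x - b) * (\<Sum>l<K. (Z i l - a * cmat_id i l) * v l)"
      by (simp add: sum_distrib_left mult_ac)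
    finally show ?thesis using shift[OF that, of a] by simp
  qed
  obtain j0 where j0: "j0 < K" "v j0 \<noteq> 0"
    using dw(1,2) by (auto simp: v_def vec_eq_iff)
  have "finite ((\<lambda>i. cmod (v i)) ` {..<K})" "(\<lambda>i. cmod (v i)) ` {..<K} \<noteq> {}" using j0 by auto
  from Max_in[OF this] obtain i where i: "i < K" "Max ((\<lambda>i. cmod (v i)) ` {..<K}) = cmod (v i)" by auto
  have max: "cmod (v j) \<le> cmod (v i)" if "j < K" for j
    unfolding i(2)[symmetric] using that by (intro Max_ge) auto
  have pos: "0 < cmod (v i)" using max[OF j0(1)] j0(2) by (meson less_le_trans zero_less_norm_iff)
  have "cmod (x - a) * cmod (x - b) * cmod (v i) = cmod (\<Sum>j<K. M i j * v j)"
    unfolding Mv[OF i(1)] by (simp add: norm_mult)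
  also have "\<dots> \<le> (\<Sum>j<K. cmod (M i j) * cmod (v i))"
    using max by (intro sum_norm_le) (auto simp: norm_mult mult_left_mono)
  finally have "cmod (x - a) * cmod (x - b) \<le> (\<Sum>j<K. cmod (M i j))"
    using pos by (simp flip: sum_distrib_right)
  also have "\<dots> \<le> (\<Sum>i<K. \<Sum>j<K. cmod (M i j))"
    using i(1) by (intro member_le_sum) (auto intro!: sum_nonneg)
  finally show ?thesis by (simp add: M_def)
qed

lemma norm_sum_mset_le:
  fixes g :: "'b \<Rightarrow> complex"
  assumes "\<And>x. x \<in># E \<Longrightarrow> cmod (g x) \<le> e"
  shows "cmod (sum_mset (image_mset g E)) \<le> real (size E) * e"
  using assms
proof (induction E)
  case (add x E)
  then have "cmod (g x + sum_mset (image_mset g E)) \<le> e + real (size E) * e"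
    by (intro norm_triangle_mono) auto
  then show ?case by (simp add: algebra_simps)
qed simp

text \<open>A linear interpolation of the test function at \<open>l1, l2\<close> is controlled by the trace alone, and
  the difference vanishes at \<open>l1, l2\<close>, near which all eigenvalues lie. For \<open>l1 = l2\<close> the slope is
  \<open>x / 0 = 0\<close>, which is what is needed.\<close>

lemma tendsto_sum_eigenvalues:
  fixes f :: "complex \<Rightarrow> real"
  assumes f: "continuous_on UNIV f"
    and M: "\<And>i j. i < K \<Longrightarrow> j < K \<Longrightarrow>
       ((\<lambda>n. \<Sum>l<K. (Z n i l - l1 * cmat_id i l) * (Z n l j - l2 * cmat_id l j)) \<longlongrightarrow> 0) F"
    and tr: "((\<lambda>n. mtrace K (Z n)) \<longlongrightarrow> l1 + of_nat (K - 1) * l2) F" and K: "0 < K"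
  shows "((\<lambda>n. sum_mset (image_mset f (eigenvalues_mset K (Z n)))) \<longlongrightarrow> f l1 + real (K - 1) * f l2) F"
proof -
  define \<beta> where "\<beta> = (complex_of_real (f l1) - complex_of_real (f l2)) / (l1 - l2)"
  define \<alpha> where "\<alpha> = f l1 - \<beta> * l1"
  define g where "g = (\<lambda>x. complex_of_real (f x) - (\<alpha> + \<beta> * x))"
  have g1: "g l1 = 0" by (simp add: g_def \<alpha>_def)
  have g2: "g l2 = 0"
  proof (cases "l1 = l2")
    case False
    have "\<beta> * (l1 - l2) = complex_of_real (f l1) - complex_of_real (f l2)" using False by (simp add: \<beta>_def)
    then show ?thesis by (simp add: g_def \<alpha>_def algebra_simps)
  qed (use g1 in simp)
  have cont: "continuous_on UNIV g"
    unfolding g_def by (intro continuous_intros f)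
  let ?E = "\<lambda>n. eigenvalues_mset K (Z n)"
  let ?\<eta> = "\<lambda>n. \<Sum>i<K. \<Sum>j<K. cmod (\<Sum>l<K. (Z n i l - l1 * cmat_id i l) * (Z n l j - l2 * cmat_id l j))"
  have \<eta>: "(?\<eta> \<longlongrightarrow> 0) F"
    by (intro tendsto_null_sum tendsto_norm_zero M) auto
  have gsum: "((\<lambda>n. sum_mset (image_mset g (?E n))) \<longlongrightarrow> 0) F"
  proof (rule tendstoI)
    fix e :: real assume e: "0 < e"
    \<comment> \<open>There are \<open>K\<close> eigenvalues, each contributing at most
      \<open>e'\<close>; the factor 2 makes the total strictly less than \<open>e\<close>.\<close>
    define e' where "e' = e / (2 * K)"
    have e': "0 < e'" using e K by (simp add: e'_def)
    have "isCont g l1" "isCont g l2" using cont by (simp_all add: continuous_on_eq_continuous_at)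
    then obtain d1 d2 where d1: "0 < d1" "\<And>x. cmod (x - l1) < d1 \<Longrightarrow> cmod (g x) < e'"
      and d2: "0 < d2" "\<And>x. cmod (x - l2) < d2 \<Longrightarrow> cmod (g x) < e'"
      using e' unfolding continuous_at_eps_delta by (metis dist_norm g1 g2 diff_zero)
    define \<delta> where "\<delta> = min d1 d2"
    have \<delta>: "0 < \<delta>" using d1 d2 by (simp add: \<delta>_def)
    have "\<forall>\<^sub>F n in F. ?\<eta> n < \<delta> * \<delta>" using \<eta> \<delta> by (intro order_tendstoD(2)) auto
    then show "\<forall>\<^sub>F n in F. dist (sum_mset (image_mset g (?E n))) 0 < e"
    proof eventually_elim
      case (elim n)
      have "cmod (g x) \<le> e'" if x: "x \<in># ?E n" for x
      proof -
        have "cmod (x - l1) * cmod (x - l2) < \<delta> * \<delta>"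
          using eigenvalue_quadratic_bound[OF x, of l1 l2] elim by linarith
        then have "cmod (x - l1) < \<delta> \<or> cmod (x - l2) < \<delta>"
          using mult_mono[of \<delta> "cmod (x - l1)" \<delta> "cmod (x - l2)"] \<delta> by fastforce
        then show ?thesis using d1 d2 by (auto simp: \<delta>_def intro: less_imp_le)
      qed
      then have "cmod (sum_mset (image_mset g (?E n))) \<le> real (size (?E n)) * e'"
        by (rule norm_sum_mset_le)
      also have "\<dots> < e" using e K by (simp add: eigenvalues_mset_size_sum e'_def field_simps)
      finally show ?case by simp
    qed
  qed
  have eq: "complex_of_real (sum_mset (image_mset f (?E n)))
      = sum_mset (image_mset g (?E n)) + (of_nat K * \<alpha> + \<beta> * mtrace K (Z n))" for n
  proof -
    have "complex_of_real (sum_mset (image_mset f E)) = sum_mset (image_mset g E) + (of_nat (size E) * \<alpha> + \<beta> * sum_mset E)" for E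
      by (induction E) (simp_all add: g_def algebra_simps)
    from this[of "?E n"] show ?thesis by (simp add: eigenvalues_mset_size_sum)
  qed
  have "((\<lambda>n. complex_of_real (sum_mset (image_mset f (?E n)))) \<longlongrightarrow>
      0 + (of_nat K * \<alpha> + \<beta> * (l1 + of_nat (K - 1) * l2))) F"
    unfolding eq by (intro tendsto_intros gsum tr)
  moreover have "0 + (of_nat K * \<alpha> + \<beta> * (l1 + of_nat (K - 1) * l2)) = complex_of_real (f l1 + real (K - 1) * f l2)"
  proof -
    have "complex_of_real (f l1) = \<alpha> + \<beta> * l1" "complex_of_real (f l2) = \<alpha> + \<beta> * l2"
      using g1 g2 by (simp_all add: g_def)
    moreover have "of_nat K = (1 :: complex) + of_nat (K - 1)" using K by (cases K) auto
    ultimately show ?thesis by (simp add: algebra_simps)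
  qed
  ultimately have "((\<lambda>n. complex_of_real (sum_mset (image_mset f (?E n)))) \<longlongrightarrow>
      complex_of_real (f l1 + real (K - 1) * f l2)) F" by simp
  then show ?thesis by (simp only: tendsto_of_real_iff)
qed

section \<open>Matrix powers and the explicit limit matrix\<close>

lemma tendsto_cmat_pow:
  assumes Z: "\<And>i j. i < K \<Longrightarrow> j < K \<Longrightarrow> ((\<lambda>n. Z n i j) \<longlongrightarrow> L i j) F" and "i < K" "j < K"
  shows "((\<lambda>n. cmat_pow K (Z n) p i j) \<longlongrightarrow> cmat_pow K L p i j) F"
  using assms(2,3)
proof (induction p arbitrary: i j)
  case (Suc p)
  then have "((\<lambda>n. \<Sum>l<K. cmat_pow K (Z n) p i l * Z n l j) \<longlongrightarrow> (\<Sum>l<K. cmat_pow K L p i l * L l j)) F"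
    by (intro tendsto_sum tendsto_mult Z) auto
  then show ?case by (simp add: cmat_pow_def cmat_mult_def)
qed (simp add: cmat_pow_def)

text \<open>\<open>on_diag k r\<close> is the \<open>r\<close>-th coordinate of \<open>\<Sum>\<^sub>a |a>|a>\<close>, so that \<open>isotropic_mat\<close> is
  \<open>(l1 - l2) / k\<close> times the rank-one matrix of this vector, plus \<open>l2\<close> times the identity.\<close>

definition on_diag :: "nat \<Rightarrow> nat \<Rightarrow> complex" where
  "on_diag k r = (if r div k = r mod k then 1 else 0)"

definition isotropic_mat :: "nat \<Rightarrow> complex \<Rightarrow> complex \<Rightarrow> cmat" where
  "isotropic_mat k l1 l2 = (\<lambda>r s. on_diag k r * on_diag k s * ((l1 - l2) / of_nat k) + l2 * cmat_id r s)"

lemma sum_on_diag: "(\<Sum>r<k\<^sup>2. on_diag k r) = of_nat k"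
proof (cases "k = 0")
  case False
  have im: "{r \<in> {..<k\<^sup>2}. r div k = r mod k} = (\<lambda>c. c * k + c) ` {..<k}"
  proof (rule Set.set_eqI, rule iffI)
    fix r assume "r \<in> {r \<in> {..<k\<^sup>2}. r div k = r mod k}"
    then show "r \<in> (\<lambda>c. c * k + c) ` {..<k}"
      using False by (intro image_eqI[of _ _ "r mod k"]) (auto, metis div_mult_mod_eq)
  next
    fix r assume "r \<in> (\<lambda>c. c * k + c) ` {..<k}"
    then obtain c where c: "r = c * k + c" "c < k" by auto
    have "c * k + c < Suc c * k" using c by simp
    also have "\<dots> \<le> k * k" using c by (intro mult_right_mono) auto
    finally show "r \<in> {r \<in> {..<k\<^sup>2}. r div k = r mod k}" using c by (simp add: power2_eq_square)
  qed
  have "(\<Sum>r<k\<^sup>2. on_diag k r) = (\<Sum>r\<in>{r \<in> {..<k\<^sup>2}. r div k = r mod k}. 1)"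
    unfolding on_diag_def by (rule sum.inter_filter[symmetric]) simp
  also have "\<dots> = of_nat k"
  proof -
    have "inj_on (\<lambda>c. c * k + c) {..<k}"
      by (rule inj_onI) (metis add.commute mult_Suc_right mult_cancel2 nat.distinct(1))
    then show ?thesis unfolding im by (subst sum.reindex) auto
  qed
  finally show ?thesis .
qed (simp add: on_diag_def)

lemma on_diag_square: "on_diag k r * on_diag k r = on_diag k r"
  by (simp add: on_diag_def)

text \<open>The span of the identity and J = w w*, with w the vector \<open>on_diag k\<close>, is an
  algebra; w has squared norm k, so J J = k J, the source of the factor
  \<open>of_nat k\<close>.\<close>

lemma isotropic_mat_product:
  assumes "i < k\<^sup>2" "j < k\<^sup>2"
  shows "(\<Sum>l<k\<^sup>2. (on_diag k i * on_diag k l * \<gamma> + b * cmat_id i l) * (on_diag k l * on_diag k j * \<gamma>' + b' * cmat_id l j))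
    = on_diag k i * on_diag k j * (of_nat k * \<gamma> * \<gamma>' + \<gamma> * b' + b * \<gamma>') + b * b' * cmat_id i j"
proof -
  have "(\<Sum>l<k\<^sup>2. (on_diag k i * on_diag k l * \<gamma> + b * cmat_id i l) * (on_diag k l * on_diag k j * \<gamma>' + b' * cmat_id l j))
    = (\<Sum>l<k\<^sup>2. on_diag k i * on_diag k j * \<gamma> * \<gamma>' * (on_diag k l * on_diag k l)
        + (if l = j then on_diag k i * on_diag k j * \<gamma> * b' else 0)
        + (if l = i then b * \<gamma>' * (on_diag k i * on_diag k j) + b * b' * cmat_id i j else 0))"
    by (intro sum.cong refl) (auto simp: cmat_id_def algebra_simps)
  also have "\<dots> = on_diag k i * on_diag k j * \<gamma> * \<gamma>' * of_nat k + on_diag k i * on_diag k j * \<gamma> * b'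
       + (b * \<gamma>' * (on_diag k i * on_diag k j) + b * b' * cmat_id i j)"
    using assms by (simp add: sum.distrib on_diag_square sum_on_diag flip: sum_distrib_left)
  finally show ?thesis by (simp add: algebra_simps)
qed

text \<open>J / k is a projection p, the two factors are (l1 - l2) (p - 1) and (l1 - l2) p, and (p -
  1) p = 0.\<close>

lemma isotropic_mat_annihilated:
  assumes "0 < k" "i < k\<^sup>2" "j < k\<^sup>2"
  shows "(\<Sum>l<k\<^sup>2. (isotropic_mat k l1 l2 i l - l1 * cmat_id i l) * (isotropic_mat k l1 l2 l j - l2 * cmat_id l j)) = 0"
proof -
  have "(\<Sum>l<k\<^sup>2. (isotropic_mat k l1 l2 i l - l1 * cmat_id i l) * (isotropic_mat k l1 l2 l j - l2 * cmat_id l j))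
    = (\<Sum>l<k\<^sup>2. (on_diag k i * on_diag k l * ((l1 - l2) / of_nat k) + (l2 - l1) * cmat_id i l)
        * (on_diag k l * on_diag k j * ((l1 - l2) / of_nat k) + 0 * cmat_id l j))"
    by (intro sum.cong refl arg_cong2[where f = times]) (simp_all add: isotropic_mat_def left_diff_distrib)
  also have "\<dots> = 0"
    unfolding isotropic_mat_product[OF assms(2,3)] using assms(1) by (simp add: field_simps)
  finally show ?thesis .
qed

text \<open>The matrix is l1 on the range of a projection and l2 on its complement, so powers act on
  the two numbers separately.\<close>

lemma cmat_pow_isotropic_mat:
  assumes "0 < k" "i < k\<^sup>2" "j < k\<^sup>2"
  shows "cmat_pow (k\<^sup>2) (isotropic_mat k l1 l2) p i j = isotropic_mat k (l1 ^ p) (l2 ^ p) i j"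
  using assms(3)
proof (induction p arbitrary: j)
  case 0 then show ?case by (simp add: cmat_pow_def isotropic_mat_def)
next
  case (Suc p)
  have "cmat_pow (k\<^sup>2) (isotropic_mat k l1 l2) (Suc p) i j
     = (\<Sum>l<k\<^sup>2. isotropic_mat k (l1 ^ p) (l2 ^ p) i l * isotropic_mat k l1 l2 l j)"
    using Suc.IH by (simp add: cmat_pow_def cmat_mult_def)
  also have "\<dots> = isotropic_mat k (l1 ^ Suc p) (l2 ^ Suc p) i j"
    unfolding isotropic_mat_def isotropic_mat_product[OF assms(2) Suc.prems]
    using assms(1) by (simp add: field_simps)
  finally show ?case .
qed

lemma mtrace_isotropic_mat:
  assumes "0 < k" shows "mtrace (k\<^sup>2) (isotropic_mat k l1 l2) = l1 + of_nat (k\<^sup>2 - 1) * l2"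
proof -
  have "mtrace (k\<^sup>2) (isotropic_mat k l1 l2) = (l1 - l2) + of_nat (k\<^sup>2) * l2"
    using assms by (simp add: mtrace_def isotropic_mat_def sum.distrib on_diag_square sum_on_diag cmat_id_def
        flip: sum_distrib_right sum_divide_distrib)
  moreover have "of_nat (k\<^sup>2) = (1 :: complex) + of_nat (k\<^sup>2 - 1)" using assms by (simp add: of_nat_diff)
  ultimately show ?thesis by (simp add: algebra_simps)
qed

section \<open>Almost sure convergence\<close>

text \<open>Here \<open>x\<close> is the counterpart at finite n of t |m|^2. For block units the
  general centre collapses to x / k times the rank-one part plus (1 - x) / k^2 times the identity,
  which is the entry of \<open>isotropic_mat\<close> with l1 - l2 = x. The estimate is then carried
  from the law of \<open>U\<close> to the underlying space.\<close>

lemma Z_mat_second_moment: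
  fixes A :: cmat
  assumes n: "0 < n" and d: "d \<le> n * k" and r: "r < k\<^sup>2" "r' < k\<^sup>2"
    and A: "(\<Sum>i<d. \<Sum>j<d. (cmod (A i j))\<^sup>2) = 1"
    and U: "U \<in> measurable M (mat_space (n * k))"
    and haar: "haar_unitary (n * k) (distr M (mat_space (n * k)) U)"
  defines "x \<equiv> complex_of_real ((cmod (mtrace d A))\<^sup>2 / real (n * k))"
  defines "z \<equiv> isotropic_mat k (x + (1 - x) / of_nat (k\<^sup>2)) ((1 - x) / of_nat (k\<^sup>2)) r r'"
  shows "integrable M (\<lambda>\<omega>. (cmod (Z_mat k n d (U \<omega>) A r r' - z))\<^sup>2)"
    and "(\<integral>\<omega>. (cmod (Z_mat k n d (U \<omega>) A r r' - z))\<^sup>2 \<partial>M)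
      \<le> 24 / (real (n * k))\<^sup>2 + 16 * (op_norm d A)\<^sup>2 / real (n * k)"
proof -
  let ?N = "n * k" and ?\<mu> = "distr M (mat_space (n * k)) U"
  let ?T = "pad d A"
  let ?P = "block_unit n (r' div k) (r div k)" and ?Q = "block_unit n (r mod k) (r' mod k)"
  let ?\<tau> = "mtrace ?N ?T"
  interpret haar_measure ?N ?\<mu> using haar by unfold_locales
  have k: "0 < k" using r by (cases k) auto
  have N: "0 < ?N" using n k by simp
  have rk: "r div k < k" "r' div k < k" "r mod k < k" "r' mod k < k"
    using r k by (auto simp: less_mult_imp_div_less power2_eq_square)
  have P: "op_bounded ?N ?P 1" and Q: "op_bounded ?N ?Q 1"
    using n rk by (auto intro: op_bounded_block_unit)
  have T: "op_bounded ?N ?T (op_norm d A)"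
    by (intro op_bounded_pad d op_bounded_op_norm)
  have T1: "frob ?N ?T = 1"
    using frob_pad_square[OF d, of A] frob_nonneg[of ?N ?T] by (simp add: A power2_eq_1_iff)
  let ?f = "\<lambda>U. mtrace ?N (cmat_mult ?N (cmat_mult ?N (orbit ?N ?T U) ?Q) (cmat_mult ?N (orbit ?N (adj ?T) U) ?P))"
  let ?c = "(?\<tau> * cnj ?\<tau> * mtrace ?N (cmat_mult ?N ?P ?Q) / of_nat ?N
         - ?\<tau> * cnj ?\<tau> * mtrace ?N ?Q * mtrace ?N ?P / of_nat (?N * ?N)
         + mtrace ?N ?Q * mtrace ?N ?P / of_nat ?N) / of_nat ?N"
  have Zf: "Z_mat k n d V A r r' = ?f V" for V
    by (rule Z_mat_eq_mtrace[OF n d r])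
  have z: "?c = z"
  proof -
    have x: "?\<tau> * cnj ?\<tau> = x * of_nat ?N"
      unfolding mtrace_pad[OF d] complex_norm_square[symmetric] x_def using N by simp
    have eq: "r = r' \<longleftrightarrow> r div k = r' div k \<and> r mod k = r' mod k"
      by (metis div_mult_mod_eq)
    \<comment> \<open>\<open>w\<close> is the entry of the rank-one part, and p q that of the
      identity: equality of r and r' splits into equality of quotients and of remainders.\<close>
    define w where "w = on_diag k r * on_diag k r'"
    define p where "p = (if r' div k = r div k then 1 else 0 :: complex)"
    define q where "q = (if r mod k = r' mod k then 1 else 0 :: complex)"
    have tr: "mtrace ?N (cmat_mult ?N ?P ?Q) = of_nat n * w"
      "mtrace ?N ?Q = of_nat n * q" "mtrace ?N ?P = of_nat n * p"
      using n rk by (simp_all add: mtrace_block_unit_mult mtrace_block_unit w_def p_def q_def on_diag_def)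
    have id: "cmat_id r r' = p * q" by (auto simp: cmat_id_def p_def q_def eq)
    have nz: "of_nat n \<noteq> (0 :: complex)" "of_nat k \<noteq> (0 :: complex)" using n k by auto
    show ?thesis
      unfolding tr x z_def isotropic_mat_def w_def[symmetric] id of_nat_mult of_nat_power
      using nz by (simp add: field_simps power2_eq_square)
  qed
  have int: "integrable ?\<mu> (\<lambda>V. (cmod (?f V - ?c))\<^sup>2)"
    and le: "(\<integral>V. (cmod (?f V - ?c))\<^sup>2 \<partial>?\<mu>) \<le> 24 / (real ?N)\<^sup>2 + 16 * (op_norm d A)\<^sup>2 / ?N"
    by (rule variance_quadratic[OF N P Q T T1])+
  have meas: "(\<lambda>V. (cmod (?f V - ?c))\<^sup>2) \<in> borel_measurable (mat_space ?N)"
    using borel_measurable_integrable[OF int] by simp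
  show "integrable M (\<lambda>\<omega>. (cmod (Z_mat k n d (U \<omega>) A r r' - z))\<^sup>2)"
    unfolding Zf z[symmetric] by (rule integrable_distr[OF U int])
  show "(\<integral>\<omega>. (cmod (Z_mat k n d (U \<omega>) A r r' - z))\<^sup>2 \<partial>M)
      \<le> 24 / (real (n * k))\<^sup>2 + 16 * (op_norm d A)\<^sup>2 / real (n * k)"
    unfolding Zf z[symmetric] using le integral_distr[OF U meas] by simp
qed

theorem theorem3p1:
  fixes k :: nat and t :: real and m :: complex
    and S :: "nat set" and d :: "nat \<Rightarrow> nat"
    and A :: "nat \<Rightarrow> cmat"
    and M :: "'a measure" and U :: "nat \<Rightarrow> 'a \<Rightarrow> (nat \<times> nat \<Rightarrow> complex)"
  assumes k2: "k \<ge> 2"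
    and t_pos: "0 < t" and t_le: "t \<le> 1"
    and S_def: "S = {n. n \<ge> 1 \<and> t * real n * real k \<in> \<int>}"
    and d_def: "\<And>n. d n = nat \<lfloor>t * real n * real k\<rfloor>"
    and A_norm: "\<And>n. n \<in> S \<Longrightarrow> (\<Sum>i<d n. \<Sum>j<d n. (cmod (A n i j))\<^sup>2) = 1"
    and A_trace: "\<exists>C N0. \<forall>n\<in>S. n \<ge> N0 \<longrightarrow>
                    cmod (mtrace (d n) (A n) / complex_of_real (sqrt (real (d n))) - m)
                      \<le> C / (real n)\<^sup>2"
    and A_opnorm: "\<exists>C N0. \<forall>n\<in>S. n \<ge> N0 \<longrightarrow> op_norm (d n) (A n) \<le> C / sqrt (real n)"
    and M_prob: "prob_space M"
    and U_meas: "\<And>n. n \<in> S \<Longrightarrow> U n \<in> measurable M (mat_space (n * k))"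
    and U_haar: "\<And>n. n \<in> S \<Longrightarrow> haar_unitary (n * k) (distr M (mat_space (n * k)) (U n))"
  shows "AE \<omega> in M.
     (let l1 = t * (cmod m)\<^sup>2 + (1 - t * (cmod m)\<^sup>2) / real (k\<^sup>2);
          l2 = (1 - t * (cmod m)\<^sup>2) / real (k\<^sup>2)
      in (\<forall>f :: complex \<Rightarrow> real. continuous_on UNIV f \<longrightarrow> bounded (range f) \<longrightarrow>
            ((\<lambda>n. (sum_mset (image_mset f (eigenvalues_mset (k\<^sup>2) (Z_mat k n (d n) (U n \<omega>) (A n)))))
                    / real (k\<^sup>2))
             \<longlongrightarrow> (f (complex_of_real l1) + real (k\<^sup>2 - 1) * f (complex_of_real l2)) / real (k\<^sup>2))
            (sequentially \<sqinter> principal S))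
       \<and> (\<forall>p :: nat. p \<ge> 1 \<longrightarrow>
            ((\<lambda>n. mtrace (k\<^sup>2) (cmat_pow (k\<^sup>2) (Z_mat k n (d n) (U n \<omega>) (A n)) p))
             \<longlongrightarrow> complex_of_real (l1 ^ p + real (k\<^sup>2 - 1) * l2 ^ p))
            (sequentially \<sqinter> principal S)))"
proof -
  let ?F = "sequentially \<sqinter> principal S"
  let ?Z = "\<lambda>n \<omega>. Z_mat k n (d n) (U n \<omega>) (A n)"
  define l1 where "l1 = t * (cmod m)\<^sup>2 + (1 - t * (cmod m)\<^sup>2) / real (k\<^sup>2)"
  define l2 where "l2 = (1 - t * (cmod m)\<^sup>2) / real (k\<^sup>2)"
  define L where "L = isotropic_mat k (complex_of_real l1) (complex_of_real l2)"
  have k0: "0 < k" using k2 by simp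
  have nS: "0 < n" "real (d n) = t * real n * real k" "d n \<le> n * k" if "n \<in> S" for n
  proof -
    show "0 < n" using that by (simp add: S_def)
    have "t * real n * real k \<in> \<int>" using that by (simp add: S_def)
    moreover have "0 \<le> t * real n * real k" using t_pos by simp
    ultimately show dn: "real (d n) = t * real n * real k" by (auto simp: d_def elim!: Ints_cases)
    have "t * real (n * k) \<le> 1 * real (n * k)" by (intro mult_right_mono t_le) simp
    then have "real (d n) \<le> real (n * k)" by (simp add: dn mult.assoc)
    then show "d n \<le> n * k" by (simp only: of_nat_le_iff)
  qed
  define x where "x = (\<lambda>n. complex_of_real ((cmod (mtrace (d n) (A n)))\<^sup>2 / real (n * k)))"
  have x_lim: "(x \<longlongrightarrow> complex_of_real (t * (cmod m)\<^sup>2)) ?F"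
  proof -
    let ?y = "\<lambda>n. mtrace (d n) (A n) / complex_of_real (sqrt (real (d n)))"
    obtain C N0 where C: "\<And>n. n \<in> S \<Longrightarrow> N0 \<le> n \<Longrightarrow> cmod (?y n - m) \<le> C / (real n)\<^sup>2"
      using A_trace by blast
    have "((\<lambda>n. C / (real n)\<^sup>2) \<longlongrightarrow> 0) sequentially" by real_asymp
    then have "((\<lambda>n. C / (real n)\<^sup>2) \<longlongrightarrow> 0) ?F" by (rule tendsto_mono[OF inf_le1])
    moreover have "\<forall>\<^sub>F n in ?F. norm (?y n - m) \<le> C / (real n)\<^sup>2"
      unfolding eventually_inf_principal
      using eventually_ge_at_top[of N0] by eventually_elim (use C in auto)
    ultimately have "((\<lambda>n. ?y n - m) \<longlongrightarrow> 0) ?F" by (rule Lim_null_comparison[rotated])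
    then have "(?y \<longlongrightarrow> m) ?F" by (rule LIM_zero_cancel)
    then have lim: "((\<lambda>n. complex_of_real (t * (cmod (?y n))\<^sup>2)) \<longlongrightarrow> complex_of_real (t * (cmod m)\<^sup>2)) ?F"
      by (intro tendsto_intros)
    have "\<forall>\<^sub>F n in ?F. complex_of_real (t * (cmod (?y n))\<^sup>2) = x n"
      unfolding eventually_inf_principal
    proof (intro always_eventually allI impI)
      fix n assume n: "n \<in> S"
      \<comment> \<open>Since \<open>d n\<close> is t n k, normalising the trace by sqrt (d n)
        instead of sqrt (n k) costs exactly the factor \<open>t\<close>.\<close>
      have "(cmod (?y n))\<^sup>2 = (cmod (mtrace (d n) (A n)))\<^sup>2 / (t * real n * real k)"
        using nS(2)[OF n] by (simp add: norm_divide power_divide)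
      then show "complex_of_real (t * (cmod (?y n))\<^sup>2) = x n"
        using t_pos nS(1)[OF n] k0 by (simp add: x_def)
    qed
    from tendsto_cong[OF this] lim show ?thesis by simp
  qed
  obtain C N0 where C: "\<And>n. n \<in> S \<Longrightarrow> N0 \<le> n \<Longrightarrow> op_norm (d n) (A n) \<le> C / sqrt (real n)"
    using A_opnorm by blast
  have entry: "AE \<omega> in M. ((\<lambda>n. ?Z n \<omega> r r') \<longlongrightarrow> L r r') ?F" if r: "r < k\<^sup>2" "r' < k\<^sup>2" for r r'
  proof -
    define z where "z = (\<lambda>n. isotropic_mat k (x n + (1 - x n) / of_nat (k\<^sup>2)) ((1 - x n) / of_nat (k\<^sup>2)) r r')"
    have z_lim: "(z \<longlongrightarrow> L r r') ?F"
    proof -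
      let ?x = "complex_of_real (t * (cmod m)\<^sup>2)"
      have "(z \<longlongrightarrow> isotropic_mat k (?x + (1 - ?x) / of_nat (k\<^sup>2)) ((1 - ?x) / of_nat (k\<^sup>2)) r r') ?F"
        unfolding z_def isotropic_mat_def using k0 by (intro tendsto_intros x_lim) auto
      then show ?thesis by (simp add: L_def l1_def l2_def)
    qed
    \<comment> \<open>Replaced by 0 off \<open>S\<close> and below \<open>N0\<close>, so that one
      moment bound holds at every natural number. At n = 0 that bound reads 0, because
      \<open>inverse 0\<close> is 0, and \<open>D 0\<close> is 0 as well.\<close>
    define D where "D = (\<lambda>n \<omega>. if n \<in> S \<and> N0 \<le> n then ?Z n \<omega> r r' - z n else 0)"
    have "integrable M (\<lambda>\<omega>. (cmod (D n \<omega>))\<^sup>2) \<and>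
       (\<integral>\<omega>. (cmod (D n \<omega>))\<^sup>2 \<partial>M) \<le> (24 + 16 * C\<^sup>2) * inverse (real n ^ 2)" for n
    proof (cases "n \<in> S \<and> N0 \<le> n")
      case True
      then have n: "n \<in> S" "N0 \<le> n" by auto
      note moment = Z_mat_second_moment[OF nS(1,3)[OF n(1)] r A_norm[OF n(1)] U_meas[OF n(1)] U_haar[OF n(1)]]
      have int: "integrable M (\<lambda>\<omega>. (cmod (?Z n \<omega> r r' - z n))\<^sup>2)"
        and le: "(\<integral>\<omega>. (cmod (?Z n \<omega> r r' - z n))\<^sup>2 \<partial>M)
          \<le> 24 / (real (n * k))\<^sup>2 + 16 * (op_norm (d n) (A n))\<^sup>2 / real (n * k)"
        unfolding z_def x_def by (rule moment)+
      \<comment> \<open>The second assumption supplies the missing factor 1 / n: the term in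
        \<open>op_norm\<close> becomes of order n^-2, like the other one.\<close>
      have c: "(op_norm (d n) (A n))\<^sup>2 \<le> C\<^sup>2 / real n"
        using power_mono[OF C[OF n] op_bounded_nonneg[OF op_bounded_op_norm], of 2] by (simp add: power_divide)
      have "24 / (real (n * k))\<^sup>2 + 16 * (op_norm (d n) (A n))\<^sup>2 / real (n * k)
          \<le> 24 / (real n)\<^sup>2 + 16 * (C\<^sup>2 / real n) / real n"
      proof (intro add_mono frac_le mult_left_mono c)
        have nk: "real n \<le> real (n * k)" using k0 by (cases k) auto
        show "real n \<le> real (n * k)" by (rule nk)
        show "(real n)\<^sup>2 \<le> (real (n * k))\<^sup>2" by (rule power_mono[OF nk]) simp
      qed (use nS(1)[OF n(1)] in auto)
      also have "\<dots> = (24 + 16 * C\<^sup>2) * inverse (real n ^ 2)"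
        by (simp add: divide_inverse power2_eq_square distrib_right)
      finally have "(\<integral>\<omega>. (cmod (?Z n \<omega> r r' - z n))\<^sup>2 \<partial>M) \<le> (24 + 16 * C\<^sup>2) * inverse (real n ^ 2)"
        using le by linarith
      moreover have "D n = (\<lambda>\<omega>. ?Z n \<omega> r r' - z n)" using True by (simp add: D_def)
      ultimately show ?thesis using int by simp
    next
      case False
      then have "D n = (\<lambda>\<omega>. 0)" by (auto simp: D_def)
      then show ?thesis by simp
    qed
    then have "AE \<omega> in M. (\<lambda>n. D n \<omega>) \<longlonglongrightarrow> 0"
      by (intro AE_tendsto_zero_of_summable_moments[where b = "\<lambda>n. (24 + 16 * C\<^sup>2) * inverse (real n ^ 2)"]
          summable_mult inverse_power_summable) auto
    then show ?thesis
    proof eventually_elim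
      case (elim \<omega>)
      then have "((\<lambda>n. D n \<omega>) \<longlongrightarrow> 0) ?F" by (rule tendsto_mono[OF inf_le1])
      then have lim: "((\<lambda>n. D n \<omega> + z n) \<longlongrightarrow> 0 + L r r') ?F" by (intro tendsto_add z_lim)
      have "\<forall>\<^sub>F n in ?F. D n \<omega> + z n = ?Z n \<omega> r r'"
        unfolding eventually_inf_principal
        using eventually_ge_at_top[of N0] by eventually_elim (auto simp: D_def)
      from tendsto_cong[OF this] lim show ?case by simp
    qed
  qed
  \<comment> \<open>Finitely many entries need only one null set. From here on everything is
    deterministic, so the same event serves all test functions and all powers.\<close>
  have "AE \<omega> in M. \<forall>r\<in>{..<k\<^sup>2}. \<forall>r'\<in>{..<k\<^sup>2}. ((\<lambda>n. ?Z n \<omega> r r') \<longlongrightarrow> L r r') ?F"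
    using entry by (intro AE_finite_allI) auto
  then show ?thesis
  proof eventually_elim
    case (elim \<omega>)
    then have Z: "((\<lambda>n. ?Z n \<omega> r r') \<longlongrightarrow> L r r') ?F" if "r < k\<^sup>2" "r' < k\<^sup>2" for r r'
      using that by auto
    have K: "0 < k\<^sup>2" using k0 by simp
    have pow: "((\<lambda>n. mtrace (k\<^sup>2) (cmat_pow (k\<^sup>2) (?Z n \<omega>) p)) \<longlongrightarrow> complex_of_real (l1 ^ p + real (k\<^sup>2 - 1) * l2 ^ p)) ?F" for p
    proof -
      have "((\<lambda>n. mtrace (k\<^sup>2) (cmat_pow (k\<^sup>2) (?Z n \<omega>) p)) \<longlongrightarrow> mtrace (k\<^sup>2) (cmat_pow (k\<^sup>2) L p)) ?F"
        unfolding mtrace_def by (intro tendsto_sum tendsto_cmat_pow Z) auto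
      also have "mtrace (k\<^sup>2) (cmat_pow (k\<^sup>2) L p) = mtrace (k\<^sup>2) (isotropic_mat k (complex_of_real l1 ^ p) (complex_of_real l2 ^ p))"
        unfolding L_def by (rule mtrace_cong) (simp add: cmat_pow_isotropic_mat k0)
      also have "\<dots> = complex_of_real (l1 ^ p + real (k\<^sup>2 - 1) * l2 ^ p)"
        by (simp add: mtrace_isotropic_mat[OF k0])
      finally show ?thesis .
    qed
    have tr: "((\<lambda>n. mtrace (k\<^sup>2) (?Z n \<omega>)) \<longlongrightarrow> complex_of_real l1 + of_nat (k\<^sup>2 - 1) * complex_of_real l2) ?F"
      unfolding mtrace_isotropic_mat[OF k0, symmetric] L_def[symmetric]
      unfolding mtrace_def by (intro tendsto_sum Z) auto
    have ann: "((\<lambda>n. \<Sum>l<k\<^sup>2. (?Z n \<omega> i l - complex_of_real l1 * cmat_id i l) * (?Z n \<omega> l j - complex_of_real l2 * cmat_id l j)) \<longlongrightarrow> 0) ?F"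
      if "i < k\<^sup>2" "j < k\<^sup>2" for i j
    proof -
      have "((\<lambda>n. \<Sum>l<k\<^sup>2. (?Z n \<omega> i l - complex_of_real l1 * cmat_id i l) * (?Z n \<omega> l j - complex_of_real l2 * cmat_id l j))
        \<longlongrightarrow> (\<Sum>l<k\<^sup>2. (L i l - complex_of_real l1 * cmat_id i l) * (L l j - complex_of_real l2 * cmat_id l j))) ?F"
        using that by (intro tendsto_intros Z) auto
      then show ?thesis unfolding L_def isotropic_mat_annihilated[OF k0 that] .
    qed
    have weak: "((\<lambda>n. sum_mset (image_mset f (eigenvalues_mset (k\<^sup>2) (?Z n \<omega>))) / real (k\<^sup>2))
        \<longlongrightarrow> (f (complex_of_real l1) + real (k\<^sup>2 - 1) * f (complex_of_real l2)) / real (k\<^sup>2)) ?F"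
      if "continuous_on UNIV f" for f :: "complex \<Rightarrow> real"
      by (intro tendsto_divide tendsto_const tendsto_sum_eigenvalues[OF that ann tr K]) (use k0 in auto)
    show ?case
      \<comment> \<open>The expression for \<open>l2\<close> is a subterm of that for
        \<open>l1\<close>, so \<open>l1\<close> has to be folded first.\<close>
      unfolding Let_def l1_def[symmetric] unfolding l2_def[symmetric]
      by (intro conjI allI impI weak pow)
  qed
qed

end
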